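(* Let $G$ be a locally compact $IN$-group, let $K_G$ be the intersection of all closed invariant neighborhoods of the identity $e$ of $G$ (a compact normal subgroup of $G$), and let $\theta: G\to G/K_G$ be the natural homomorphism. Then $$WS(G)=\{h\circ\theta : h\in WS(G/K_G)\}.$$
   Context: A subset of a group $G$ is invariant if it is invariant under all inner automorphisms of $G$. A locally compact group $G$ is an $IN$-group if it has a compact invariant neighborhood of the identity $e$. It is known that for an $IN$-group $G$ the intersection $K_G$ of all closed invariant neighborhoods of $e$ is a compact normal subgroup of $G$. For a locally compact group $G$, $C(G)$ denotes the $C^*$-algebra of bounded continuous complex-valued functions on $G$ with the sup norm; for $f\in C(G)$ and $x,y\in G$ put ${}_xf_y(z)=f(xzy)$, and let $O(f)=\{{}_xf_y: x,y\in G\}$ be the double orbit. $WS(G)=\{f\in C(G): O(f)\text{ is relatively weakly compact in } C(G)\}$. *)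

theory Defs
  imports "HOL-Analysis.Analysis" "HOL-Algebra.Coset"
begin

text \<open>A topological group is given by a group \<open>G\<close> of HOL-Algebra together with a topology \<open>T\<close>
  on its carrier, so that the quotient by a subgroup is again an object of the same kind.\<close>

locale topological_group = group G
  for G :: "('a, 'b) monoid_scheme" (structure) and T :: "'a topology" +
  assumes topspace_eq_carrier: "topspace T = carrier G"
    and continuous_mult: "continuous_map (prod_topology T T) T (\<lambda>(x, y). x \<otimes> y)"
    and continuous_inv: "continuous_map T T (\<lambda>x. inv x)"

text \<open>Locally compact groups are Hausdorff by the usual convention.\<close>

locale locally_compact_group = topological_group +
  assumes Hausdorff: "Hausdorff_space T"
    and locally_compact: "locally_compact_space T"

definition invariant_subset :: "('a, 'b) monoid_scheme \<Rightarrow> 'a set \<Rightarrow> bool" where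
  "invariant_subset G A \<longleftrightarrow> A \<subseteq> carrier G \<and>
     (\<forall>x\<in>carrier G. (\<lambda>a. x \<otimes>\<^bsub>G\<^esub> a \<otimes>\<^bsub>G\<^esub> inv\<^bsub>G\<^esub> x) ` A = A)"

text \<open>Neighborhoods of the identity need not be open.\<close>

definition invariant_nhd_one :: "('a, 'b) monoid_scheme \<Rightarrow> 'a topology \<Rightarrow> 'a set \<Rightarrow> bool" where
  "invariant_nhd_one G T V \<longleftrightarrow> invariant_subset G V \<and> \<one>\<^bsub>G\<^esub> \<in> T interior_of V"

locale IN_group = locally_compact_group +
  assumes compact_invariant_nhd: "\<exists>V. invariant_nhd_one G T V \<and> compactin T V"

definition IN_kernel :: "('a, 'b) monoid_scheme \<Rightarrow> 'a topology \<Rightarrow> 'a set" where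
  "IN_kernel G T = \<Inter>{V. invariant_nhd_one G T V \<and> closedin T V}"

definition quotient_top :: "'a topology \<Rightarrow> ('a \<Rightarrow> 'c) \<Rightarrow> 'c topology" where
  "quotient_top X f =
     topology (\<lambda>U. U \<subseteq> f ` topspace X \<and> openin X {x \<in> topspace X. f x \<in> U})"

lemma openin_quotient_top:
  "openin (quotient_top X f) U \<longleftrightarrow> U \<subseteq> f ` topspace X \<and> openin X {x \<in> topspace X. f x \<in> U}"
proof -
  have "istopology (\<lambda>U. U \<subseteq> f ` topspace X \<and> openin X {x \<in> topspace X. f x \<in> U})"
    unfolding istopology_def
  proof (intro conjI allI impI)
    fix S U
    assume "S \<subseteq> f ` topspace X \<and> openin X {x \<in> topspace X. f x \<in> S}"
      and "U \<subseteq> f ` topspace X \<and> openin X {x \<in> topspace X. f x \<in> U}"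
    moreover have "{x \<in> topspace X. f x \<in> S \<inter> U} =
        {x \<in> topspace X. f x \<in> S} \<inter> {x \<in> topspace X. f x \<in> U}"
      by blast
    ultimately show "S \<inter> U \<subseteq> f ` topspace X" "openin X {x \<in> topspace X. f x \<in> S \<inter> U}"
      by auto
  next
    fix K
    assume K: "\<forall>S\<in>K. S \<subseteq> f ` topspace X \<and> openin X {x \<in> topspace X. f x \<in> S}"
    then show "\<Union>K \<subseteq> f ` topspace X"
      by blast
    have "{x \<in> topspace X. f x \<in> \<Union>K} = \<Union>((\<lambda>S. {x \<in> topspace X. f x \<in> S}) ` K)"
      by blast
    with K show "openin X {x \<in> topspace X. f x \<in> \<Union>K}"
      by (auto intro!: openin_Union)
  qed
  then show ?thesis
    by (simp add: quotient_top_def)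
qed

lemma topspace_quotient_top [simp]: "topspace (quotient_top X f) = f ` topspace X"
proof -
  have eq: "{x \<in> topspace X. f x \<in> f ` topspace X} = topspace X"
    by blast
  have "openin (quotient_top X f) (f ` topspace X)"
    by (simp add: openin_quotient_top eq)
  moreover have "topspace (quotient_top X f) \<subseteq> f ` topspace X"
    using openin_topspace[of "quotient_top X f"] unfolding openin_quotient_top by (rule conjunct1)
  ultimately show ?thesis
    by (meson openin_subset subset_antisym)
qed

lemma quotient_map_quotient_top: "quotient_map X (quotient_top X f) f"
  by (simp add: quotient_map_def openin_quotient_top)

text \<open>The points of \<open>G Mod N\<close> are the right cosets of \<open>N\<close>.\<close>

definition coset_topology ::
    "('a, 'b) monoid_scheme \<Rightarrow> 'a topology \<Rightarrow> 'a set \<Rightarrow> 'a set topology" where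
  "coset_topology G T N = quotient_top T (\<lambda>x. N #>\<^bsub>G\<^esub> x)"

text \<open>Functions on \<open>topspace X\<close> are represented by their extensional representatives.\<close>

definition bdd_cont :: "'a topology \<Rightarrow> ('a \<Rightarrow> complex) set" where
  "bdd_cont X = {f \<in> extensional (topspace X).
     continuous_map X euclidean f \<and> bounded (f ` topspace X)}"

definition sup_norm :: "'a topology \<Rightarrow> ('a \<Rightarrow> complex) \<Rightarrow> real" where
  "sup_norm X f = (SUP x\<in>topspace X. norm (f x))"

text \<open>Bounded complex-linear functionals on \<open>C(X)\<close>; values outside \<open>bdd_cont X\<close> are irrelevant.\<close>

definition bdd_cont_dual :: "'a topology \<Rightarrow> (('a \<Rightarrow> complex) \<Rightarrow> complex) set" where
  "bdd_cont_dual X = {\<phi>.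
     (\<forall>f\<in>bdd_cont X. \<forall>g\<in>bdd_cont X. \<phi> (\<lambda>x\<in>topspace X. f x + g x) = \<phi> f + \<phi> g) \<and>
     (\<forall>c. \<forall>f\<in>bdd_cont X. \<phi> (\<lambda>x\<in>topspace X. c * f x) = c * \<phi> f) \<and>
     (\<exists>B. \<forall>f\<in>bdd_cont X. norm (\<phi> f) \<le> B * sup_norm X f)}"

definition weak_topology :: "'a topology \<Rightarrow> ('a \<Rightarrow> complex) topology" where
  "weak_topology X = topology_generated_by
     {{f \<in> bdd_cont X. \<phi> f \<in> U} | \<phi> U. \<phi> \<in> bdd_cont_dual X \<and> open U}"

lemma topspace_weak_topology [simp]: "topspace (weak_topology X) = bdd_cont X"
proof -
  have "(\<lambda>_. 0) \<in> bdd_cont_dual X"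
    by (auto simp: bdd_cont_dual_def intro!: exI[of _ 0])
  then have "bdd_cont X \<in> {{f \<in> bdd_cont X. \<phi> f \<in> U} | \<phi> U. \<phi> \<in> bdd_cont_dual X \<and> open U}"
    by (intro CollectI exI[of _ "\<lambda>_. 0"] exI[of _ UNIV]) auto
  then have "\<Union>{{f \<in> bdd_cont X. \<phi> f \<in> U} | \<phi> U. \<phi> \<in> bdd_cont_dual X \<and> open U} = bdd_cont X"
    by blast
  then show ?thesis
    by (simp add: weak_topology_def)
qed

definition relatively_weakly_compact :: "'a topology \<Rightarrow> ('a \<Rightarrow> complex) set \<Rightarrow> bool" where
  "relatively_weakly_compact X S \<longleftrightarrow>
     S \<subseteq> bdd_cont X \<and> compactin (weak_topology X) (weak_topology X closure_of S)"

definition double_orbit ::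
    "('a, 'b) monoid_scheme \<Rightarrow> ('a \<Rightarrow> complex) \<Rightarrow> ('a \<Rightarrow> complex) set" where
  "double_orbit G f =
     {(\<lambda>z\<in>carrier G. f (x \<otimes>\<^bsub>G\<^esub> z \<otimes>\<^bsub>G\<^esub> y)) | x y. x \<in> carrier G \<and> y \<in> carrier G}"

definition WS :: "('a, 'b) monoid_scheme \<Rightarrow> 'a topology \<Rightarrow> ('a \<Rightarrow> complex) set" where
  "WS G T = {f \<in> bdd_cont T. relatively_weakly_compact T (double_orbit G f)}"

end

theory Submission
  imports Defs "HOL-Probability.Discrete_Topology"
begin

text \<open>
  Composition with \<open>\<theta>\<close> identifies the functions on \<open>G/K\<close> with the functions on \<open>G\<close> that are constant
  on the cosets of \<open>K\<close>, and it carries double orbits to double orbits. The theorem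
  therefore amounts to three facts about the kernel \<open>K\<close> of an IN-group.

  \<^item> \<open>K\<close> is a normal subgroup (\<open>normal_IN_kernel\<close>). Only products are a problem: multiplication by an
  element of \<open>K\<close> has to preserve the closure of an open invariant set \<open>A\<close> with compact closure.
  An element of \<open>K\<close> is a limit of conjugates of elements near the identity. If it failed to preserve
  that closure, arbitrarily many disjoint subsets of \<open>A\<close> would arise, all of them translates of
  conjugates of one fixed compact neighborhood of the identity, too many to fit into a compact
  invariant neighborhood. Covering numbers, in place of a Haar measure,
  make this precise (\<open>card_disjoint_family_le\<close>).

  \<^item> Every \<open>f\<close> in \<open>WS(G)\<close> is constant on the cosets of \<open>K\<close> (\<open>WS_IN_kernel_invariant\<close>). A weakly compact
  set of continuous functions on a locally compact space is nearly equicontinuous somewhere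
  (\<open>weakly_compact_small_oscillation\<close>). For the double orbit of \<open>f\<close>, translation moves this place to the
  identity, so that \<open>f (a u b)\<close> is close to \<open>f (a b)\<close> for all \<open>a\<close>, \<open>b\<close> as soon as \<open>u\<close> is close to the
  identity. Choosing \<open>a\<close> and \<open>b\<close> suitably, the same holds for all conjugates of \<open>u\<close> and their limits, that
  is, for all elements of \<open>K\<close>, and with arbitrarily small error.

  \<^item> A set of functions on \<open>G/K\<close> is relatively weakly compact if and only if its image in \<open>C(G)\<close> is
  (\<open>relatively_weakly_compact_compose\<close>). By the Hahn--Banach theorem, the weak topology of \<open>C(G/K)\<close> is
  induced from that of \<open>C(G)\<close>.
\<close>

(* Leaves closure_of to the topological closure. *)
no_notation eq_closure_of (\<open>closure'_of\<index>\<close>)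

section \<open>The kernel of an IN-group is a normal subgroup\<close>

lemma (in group) mult_inv_cancel [simp]:
  assumes "x \<in> carrier G" "a \<in> carrier G"
  shows "x \<otimes> (inv x \<otimes> a) = a" "inv x \<otimes> (x \<otimes> a) = a"
  using assms by (simp_all flip: m_assoc)

context topological_group
begin

lemma openin_subset_carrier: "openin T U \<Longrightarrow> U \<subseteq> carrier G"
  using openin_subset topspace_eq_carrier by blast

lemma continuous_map_group_mult [intro]:
  assumes "continuous_map X T f" "continuous_map X T g"
  shows "continuous_map X T (\<lambda>x. f x \<otimes> g x)"
  using continuous_map_compose[OF continuous_map_pairedI[OF assms] continuous_mult]
  by (simp add: o_def)

lemma continuous_map_group_inv [intro]:
  assumes "continuous_map X T f"
  shows "continuous_map X T (\<lambda>x. inv (f x))"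
  using continuous_map_compose[OF assms continuous_inv] by (simp add: o_def)

lemma continuous_map_group_const [intro]:
  "c \<in> carrier G \<Longrightarrow> continuous_map X T (\<lambda>x. c)"
  by (simp add: topspace_eq_carrier)

lemma continuous_map_conj:
  "x \<in> carrier G \<Longrightarrow> continuous_map T T (\<lambda>a. x \<otimes> a \<otimes> inv x)"
  by (intro continuous_map_group_mult continuous_map_group_const) auto

lemma openin_group_preimage:
  assumes "continuous_map T T f" "openin T U"
  shows "openin T {x \<in> carrier G. f x \<in> U}"
  using openin_continuous_map_preimage[OF assms] by (simp add: topspace_eq_carrier)

lemma closedin_group_preimage:
  assumes "continuous_map T T f" "closedin T U"
  shows "closedin T {x \<in> carrier G. f x \<in> U}"
  using closedin_continuous_map_preimage[OF assms] by (simp add: topspace_eq_carrier)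

lemma conj_conj:
  "\<lbrakk>x \<in> carrier G; a \<in> carrier G\<rbrakk> \<Longrightarrow> x \<otimes> (inv x \<otimes> a \<otimes> x) \<otimes> inv x = a"
  "\<lbrakk>x \<in> carrier G; a \<in> carrier G\<rbrakk> \<Longrightarrow> inv x \<otimes> (x \<otimes> a \<otimes> inv x) \<otimes> x = a"
  by (simp_all add: m_assoc)

lemma invariant_subsetI:
  assumes "A \<subseteq> carrier G"
    and "\<And>x a. \<lbrakk>x \<in> carrier G; a \<in> A\<rbrakk> \<Longrightarrow> x \<otimes> a \<otimes> inv x \<in> A"
  shows "invariant_subset G A"
  unfolding invariant_subset_def
proof (intro conjI ballI assms(1) subset_antisym subsetI)
  fix x a assume x: "x \<in> carrier G" and a: "a \<in> A"
  then have "inv x \<otimes> a \<otimes> x \<in> A"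
    using assms(2)[of "inv x" a] by simp
  moreover have "a = x \<otimes> (inv x \<otimes> a \<otimes> x) \<otimes> inv x"
    using x a assms(1) by (simp add: conj_conj subset_iff)
  ultimately show "a \<in> (\<lambda>a. x \<otimes> a \<otimes> inv x) ` A"
    by blast
qed (use assms(2) in blast)

lemma invariant_subsetD:
  assumes "invariant_subset G A" "a \<in> A" "x \<in> carrier G"
  shows "x \<otimes> a \<otimes> inv x \<in> A"
  using assms unfolding invariant_subset_def by blast

lemma invariant_subsetD':
  assumes "invariant_subset G A" "a \<in> A" "x \<in> carrier G"
  shows "inv x \<otimes> a \<otimes> x \<in> A"
  using invariant_subsetD[of A a "inv x"] assms by simp

lemma invariant_subset_carrier: "invariant_subset G A \<Longrightarrow> A \<subseteq> carrier G"
  by (simp add: invariant_subset_def)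

lemma invariant_subset_interior_of:
  assumes "invariant_subset G A"
  shows "invariant_subset G (T interior_of A)"
proof (rule invariant_subsetI)
  show "T interior_of A \<subseteq> carrier G"
    using interior_of_subset_topspace topspace_eq_carrier by metis
  fix x a assume x: "x \<in> carrier G" and a: "a \<in> T interior_of A"
  define U where "U = {y \<in> carrier G. inv x \<otimes> y \<otimes> x \<in> T interior_of A}"
  have "openin T U"
    unfolding U_def using continuous_map_conj[of "inv x"] x
    by (intro openin_group_preimage) auto
  moreover have "U \<subseteq> A"
  proof
    fix y assume "y \<in> U"
    then have "y \<in> carrier G" "inv x \<otimes> y \<otimes> x \<in> A"
      unfolding U_def using interior_of_subset[of T A] by auto
    then show "y \<in> A"
      using invariant_subsetD[OF assms, of "inv x \<otimes> y \<otimes> x" x] x by (simp add: conj_conj)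
  qed
  moreover have "x \<otimes> a \<otimes> inv x \<in> U"
    using x a \<open>T interior_of A \<subseteq> carrier G\<close> by (auto simp: U_def conj_conj)
  ultimately show "x \<otimes> a \<otimes> inv x \<in> T interior_of A"
    by (meson interior_of_maximal subsetD)
qed

lemma invariant_subset_closure_of:
  assumes "invariant_subset G A"
  shows "invariant_subset G (T closure_of A)"
proof (rule invariant_subsetI)
  show "T closure_of A \<subseteq> carrier G"
    using closure_of_subset_topspace topspace_eq_carrier by metis
  fix x a assume x: "x \<in> carrier G" and a: "a \<in> T closure_of A"
  have "(\<lambda>a. x \<otimes> a \<otimes> inv x) ` (T closure_of A) \<subseteq> T closure_of ((\<lambda>a. x \<otimes> a \<otimes> inv x) ` A)"
    using continuous_map_conj[OF x] by (rule continuous_map_image_closure_subset)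
  also have "(\<lambda>a. x \<otimes> a \<otimes> inv x) ` A = A"
    using assms x by (simp add: invariant_subset_def)
  finally show "x \<otimes> a \<otimes> inv x \<in> T closure_of A"
    using a by blast
qed

text \<open>The kernel is the set of limits of conjugates of elements that tend to the identity: the union
of the conjugates of any neighborhood \<open>N\<close> of \<open>\<one>\<close> is invariant, so its closure takes part in the
intersection that defines the kernel.\<close>

lemma IN_kernel_approx:
  assumes k: "k \<in> IN_kernel G T" and Y: "openin T Y" "k \<in> Y" and N: "openin T N" "\<one> \<in> N"
  obtains u x where "u \<in> N" "x \<in> carrier G" "x \<otimes> u \<otimes> inv x \<in> Y"
proof -
  define A where "A = (\<Union>x\<in>carrier G. {y \<in> carrier G. inv x \<otimes> y \<otimes> x \<in> N})"
  have "openin T A"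
    unfolding A_def
  proof (intro openin_Union ballI, clarify)
    fix x assume "x \<in> carrier G"
    then show "openin T {y \<in> carrier G. inv x \<otimes> y \<otimes> x \<in> N}"
      using continuous_map_conj[of "inv x"] N by (intro openin_group_preimage) auto
  qed
  have "\<one> \<in> A"
    using N by (auto simp: A_def intro!: bexI[of _ \<one>])
  have A: "A \<subseteq> carrier G"
    by (auto simp: A_def)
  have inv: "invariant_subset G A"
  proof (rule invariant_subsetI[OF A])
    fix g a assume g: "g \<in> carrier G" and "a \<in> A"
    then obtain x where x: "x \<in> carrier G" "a \<in> carrier G" "inv x \<otimes> a \<otimes> x \<in> N"
      by (auto simp: A_def)
    have "inv (g \<otimes> x) \<otimes> (g \<otimes> a \<otimes> inv g) \<otimes> (g \<otimes> x) = inv x \<otimes> (inv g \<otimes> (g \<otimes> a \<otimes> inv g) \<otimes> g) \<otimes> x"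
      using g x(1,2) by (simp add: inv_mult_group m_assoc)
    then have "inv (g \<otimes> x) \<otimes> (g \<otimes> a \<otimes> inv g) \<otimes> (g \<otimes> x) \<in> N"
      using g x by (simp add: conj_conj)
    then show "g \<otimes> a \<otimes> inv g \<in> A"
      unfolding A_def using g x(1,2) by blast
  qed
  have "A \<subseteq> T closure_of A"
    using A by (simp add: closure_of_subset topspace_eq_carrier)
  then have "\<one> \<in> T interior_of (T closure_of A)"
    using \<open>openin T A\<close> \<open>\<one> \<in> A\<close> interior_of_maximal by blast
  then have "invariant_nhd_one G T (T closure_of A)"
    using invariant_subset_closure_of[OF inv] by (simp add: invariant_nhd_one_def)
  then have "k \<in> T closure_of A"
    using k by (auto simp: IN_kernel_def)
  then obtain a where "a \<in> A" "a \<in> Y"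
    using Y by (auto simp: in_closure_of)
  then obtain x where "x \<in> carrier G" "a \<in> carrier G" "inv x \<otimes> a \<otimes> x \<in> N"
    by (auto simp: A_def)
  then show thesis
    using that[of "inv x \<otimes> a \<otimes> x" x] \<open>a \<in> Y\<close> by (simp add: conj_conj)
qed

lemma one_nhd_quotient:
  assumes "openin T O'" "\<one> \<in> O'"
  obtains W where "openin T W" "\<one> \<in> W" "\<And>v w. \<lbrakk>v \<in> W; w \<in> W\<rbrakk> \<Longrightarrow> inv v \<otimes> w \<in> O'"
proof -
  have "continuous_map (prod_topology T T) T (\<lambda>p. inv (fst p) \<otimes> snd p)"
    by (intro continuous_map_group_mult continuous_map_group_inv continuous_map_fst continuous_map_snd)
  from openin_continuous_map_preimage[OF this assms(1)]
  have "openin (prod_topology T T) {p \<in> carrier G \<times> carrier G. inv (fst p) \<otimes> snd p \<in> O'}"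
    by (simp add: topspace_eq_carrier)
  moreover have "(\<one>,\<one>) \<in> {p \<in> carrier G \<times> carrier G. inv (fst p) \<otimes> snd p \<in> O'}"
    using assms by simp
  ultimately obtain U V where UV: "openin T U" "openin T V" "\<one> \<in> U" "\<one> \<in> V"
      "U \<times> V \<subseteq> {p \<in> carrier G \<times> carrier G. inv (fst p) \<otimes> snd p \<in> O'}"
    unfolding openin_prod_topology_alt by meson
  show thesis
  proof
    show "openin T (U \<inter> V)" "\<one> \<in> U \<inter> V"
      using UV by auto
    show "inv v \<otimes> w \<in> O'" if "v \<in> U \<inter> V" "w \<in> U \<inter> V" for v w
      using that UV(5) by auto
  qed
qed

text \<open>\<open>B\<inverse>B'\<close> is compact, hence closed, and misses the identity; so sufficiently small left translates
cannot meet both \<open>B\<close> and \<open>B'\<close>.\<close>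

lemma separate_disjoint_compacts:
  assumes "Hausdorff_space T" "compactin T B" "compactin T B'" "B \<inter> B' = {}"
  obtains W where "openin T W" "\<one> \<in> W"
    "\<And>x v w. \<lbrakk>x \<in> carrier G; v \<in> W; w \<in> W; x \<otimes> v \<in> B\<rbrakk> \<Longrightarrow> x \<otimes> w \<notin> B'"
proof -
  define C where "C = (\<lambda>p. inv (fst p) \<otimes> snd p) ` (B \<times> B')"
  have BB': "B \<subseteq> carrier G" "B' \<subseteq> carrier G"
    using assms compactin_subset_topspace topspace_eq_carrier by metis+
  have "compactin (prod_topology T T) (B \<times> B')"
    using assms by (simp add: compactin_Times)
  moreover have "continuous_map (prod_topology T T) T (\<lambda>p. inv (fst p) \<otimes> snd p)"
    by (intro continuous_map_group_mult continuous_map_group_inv continuous_map_fst continuous_map_snd)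
  ultimately have "compactin T C"
    unfolding C_def by (rule image_compactin)
  then have "openin T (carrier G - C)"
    using assms(1) compactin_imp_closedin topspace_eq_carrier by (metis closedin_def)
  moreover have "\<one> \<notin> C"
  proof
    assume "\<one> \<in> C"
    then obtain b b' where "b \<in> B" "b' \<in> B'" "\<one> = inv b \<otimes> b'"
      by (auto simp: C_def)
    then have "b = b'"
      using BB' by (metis mult_inv_cancel(1) r_one subsetD)
    then show False
      using \<open>b \<in> B\<close> \<open>b' \<in> B'\<close> assms(4) by blast
  qed
  ultimately obtain W where W: "openin T W" "\<one> \<in> W"
      "\<And>v w. \<lbrakk>v \<in> W; w \<in> W\<rbrakk> \<Longrightarrow> inv v \<otimes> w \<in> carrier G - C"
    by (meson DiffI one_closed one_nhd_quotient)
  show thesis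
  proof
    fix x v w assume *: "x \<in> carrier G" "v \<in> W" "w \<in> W" "x \<otimes> v \<in> B"
    show "x \<otimes> w \<notin> B'"
    proof
      assume "x \<otimes> w \<in> B'"
      then have "inv (x \<otimes> v) \<otimes> (x \<otimes> w) \<in> C"
        using * by (force simp: C_def)
      moreover have "v \<in> carrier G" "w \<in> carrier G"
        using * W(1) openin_subset_carrier by blast+
      then have "inv (x \<otimes> v) \<otimes> (x \<otimes> w) = inv v \<otimes> w"
        using * by (simp add: inv_mult_group m_assoc)
      ultimately show False
        using W(3) * by auto
    qed
  qed (use W in auto)
qed

end

text \<open>The left translates of \<open>B\<close> by the finite set \<open>F\<close> cover \<open>V\<close>. Membership in a translate is
expressed through \<open>inv s \<otimes> v\<close>, so that open translates are preimages under continuous maps.\<close>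

definition left_cover :: "('a, 'b) monoid_scheme \<Rightarrow> 'a set \<Rightarrow> 'a set \<Rightarrow> 'a set \<Rightarrow> bool" where
  "left_cover G F B V \<longleftrightarrow> finite F \<and> F \<subseteq> carrier G \<and>
     (\<forall>v\<in>V. \<exists>s\<in>F. inv\<^bsub>G\<^esub> s \<otimes>\<^bsub>G\<^esub> v \<in> B)"

lemma (in group) left_cover_trans:
  assumes "left_cover G F B V" "left_cover G E W B" "V \<subseteq> carrier G"
  shows "left_cover G ((\<lambda>(s, x). s \<otimes> x) ` (F \<times> E)) W V"
  unfolding left_cover_def
proof (intro conjI ballI)
  fix v assume v: "v \<in> V"
  then obtain s where s: "s \<in> F" "inv s \<otimes> v \<in> B"
    using assms(1) by (auto simp: left_cover_def)
  then obtain x where x: "x \<in> E" "inv x \<otimes> (inv s \<otimes> v) \<in> W"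
    using assms(2) by (auto simp: left_cover_def)
  have "inv (s \<otimes> x) \<otimes> v = inv x \<otimes> (inv s \<otimes> v)"
    using s x v assms by (simp add: left_cover_def subset_iff inv_mult_group m_assoc)
  then show "\<exists>s\<in>(\<lambda>(s, x). s \<otimes> x) ` (F \<times> E). inv s \<otimes> v \<in> W"
    using s x by force
qed (use assms in \<open>auto simp: left_cover_def\<close>)

context topological_group
begin

lemma compact_left_cover:
  assumes "compactin T V" "openin T W" "\<one> \<in> W"
  obtains F where "left_cover G F W V"
proof -
  define U where "U s = {v \<in> carrier G. inv s \<otimes> v \<in> W}" for s
  have V: "V \<subseteq> carrier G"
    using assms compactin_subset_topspace topspace_eq_carrier by metis
  have "openin T (U s)" if "s \<in> V" for s
    unfolding U_def using assms that V
    by (intro openin_group_preimage continuous_map_group_mult continuous_map_group_const) auto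
  moreover have "v \<in> U v" if "v \<in> V" for v
    using V assms(3) that by (simp add: U_def subset_iff)
  then have "V \<subseteq> \<Union> (U ` V)"
    by blast
  ultimately obtain \<F> where "finite \<F>" "\<F> \<subseteq> U ` V" "V \<subseteq> \<Union>\<F>"
    using compactinD[OF assms(1), of "U ` V"] by blast
  then obtain F where F: "F \<subseteq> V" "finite F" "V \<subseteq> \<Union> (U ` F)"
    using finite_subset_image[of \<F> U V] by auto
  then have "left_cover G F W V"
    using V unfolding left_cover_def U_def by fastforce
  then show thesis ..
qed

text \<open>A packing bound that does the work of a Haar measure. With a left invariant measure, a set that
covers \<open>V\<close> by \<open>M\<close> left translates would have at least \<open>1 / M\<close> of the measure of \<open>V\<close>, so at most \<open>M\<close> of
them could be disjoint inside \<open>V\<close>. In place of the measure one takes the number \<open>m\<close> of translates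
of a small set \<open>W\<close> in a minimal cover of \<open>V\<close>: if no translate of \<open>W\<close> meets two members of the
family, the translates are shared out among the members, and each member needs at least
\<open>m / M\<close> of them, because \<open>M\<close> copies of its share cover \<open>V\<close>.\<close>

lemma card_disjoint_family_le:
  assumes H: "Hausdorff_space T" and V: "compactin T V" "V \<noteq> {}" and fin: "finite \<B>"
    and disj: "pairwise disjnt \<B>"
    and cpt: "\<And>B. B \<in> \<B> \<Longrightarrow> compactin T B" and sub: "\<And>B. B \<in> \<B> \<Longrightarrow> B \<subseteq> V"
    and cov: "\<And>B. B \<in> \<B> \<Longrightarrow> \<exists>F. left_cover G F B V \<and> card F \<le> M"
  shows "card \<B> \<le> M"
proof -
  have VG: "V \<subseteq> carrier G"
    using V compactin_subset_topspace topspace_eq_carrier by metis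
  define \<P> where "\<P> = {(B, B') \<in> \<B> \<times> \<B>. B \<noteq> B'}"
  have "finite \<P>"
    unfolding \<P>_def using fin by (auto intro: finite_subset[OF _ finite_cartesian_product])
  have "\<exists>W. openin T W \<and> \<one> \<in> W \<and>
      (\<forall>x v w. x \<in> carrier G \<longrightarrow> v \<in> W \<longrightarrow> w \<in> W \<longrightarrow> x \<otimes> v \<in> fst p \<longrightarrow> x \<otimes> w \<notin> snd p)"
    if "p \<in> \<P>" for p
  proof -
    have "fst p \<in> \<B>" "snd p \<in> \<B>" "fst p \<noteq> snd p"
      using that by (auto simp: \<P>_def)
    then have "fst p \<inter> snd p = {}" "compactin T (fst p)" "compactin T (snd p)"
      using disj cpt by (simp_all add: pairwise_def disjnt_def)
    then show ?thesis
      using separate_disjoint_compacts[OF H, of "fst p" "snd p"] by metis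
  qed
  then obtain w where w: "\<And>p. p \<in> \<P> \<Longrightarrow> openin T (w p) \<and> \<one> \<in> w p \<and>
      (\<forall>x v v'. x \<in> carrier G \<longrightarrow> v \<in> w p \<longrightarrow> v' \<in> w p \<longrightarrow> x \<otimes> v \<in> fst p \<longrightarrow> x \<otimes> v' \<notin> snd p)"
    by metis
  define W where "W = \<Inter> (insert (carrier G) (w ` \<P>))"
  have W: "openin T W"
    unfolding W_def using \<open>finite \<P>\<close> w
    by (intro openin_Inter) (auto simp flip: topspace_eq_carrier)
  have W1: "\<one> \<in> W"
    using w by (auto simp: W_def)
  have sep: "B = B'" if "B \<in> \<B>" "B' \<in> \<B>" "x \<in> carrier G" "v \<in> W" "v' \<in> W"
      "x \<otimes> v \<in> B" "x \<otimes> v' \<in> B'" for B B' x v v'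
  proof (rule ccontr)
    assume "B \<noteq> B'"
    then have p: "(B, B') \<in> \<P>"
      using that by (auto simp: \<P>_def)
    then have "v \<in> w (B, B')" "v' \<in> w (B, B')"
      using that by (auto simp: W_def)
    then show False
      using w[OF p] that by auto
  qed
  define m where "m = (LEAST n. \<exists>F. left_cover G F W V \<and> card F = n)"
  have "\<exists>n F. left_cover G F W V \<and> card F = n"
    using compact_left_cover[OF V(1) W W1] by metis
  then have "\<exists>F. left_cover G F W V \<and> card F = m"
    unfolding m_def by (rule LeastI_ex)
  then obtain F where F: "left_cover G F W V" "card F = m"
    by blast
  have m_le: "m \<le> card E" if "left_cover G E W V" for E
    unfolding m_def using that by (auto intro: Least_le)
  have "F \<noteq> {}" "finite F"
    using F V(2) by (auto simp: left_cover_def)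
  then have "m > 0"
    using F by auto
  define E where "E B = {x \<in> F. \<exists>v\<in>W. x \<otimes> v \<in> B}" for B
  have covE: "left_cover G (E B) W B" if B: "B \<in> \<B>" for B
    unfolding left_cover_def
  proof (intro conjI ballI)
    fix b assume b: "b \<in> B"
    then obtain x where x: "x \<in> F" "inv x \<otimes> b \<in> W"
      using F(1) sub[OF B] unfolding left_cover_def by blast
    then have xG: "x \<in> carrier G" "b \<in> carrier G"
      using F b sub[OF B] VG by (auto simp: left_cover_def)
    then have "x \<otimes> (inv x \<otimes> b) = b"
      by (simp add: m_assoc [symmetric])
    then have "x \<in> E B"
      using x b by (auto simp: E_def intro!: bexI[of _ "inv x \<otimes> b"])
    then show "\<exists>x\<in>E B. inv x \<otimes> b \<in> W"
      using x by blast
  qed (use F in \<open>auto simp: E_def left_cover_def\<close>)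
  have big: "m \<le> M * card (E B)" if B: "B \<in> \<B>" for B
  proof -
    obtain S where S: "left_cover G S B V" "card S \<le> M"
      using cov[OF B] by blast
    have "m \<le> card ((\<lambda>(s, x). s \<otimes> x) ` (S \<times> E B))"
      using left_cover_trans[OF S(1) covE[OF B] VG] by (rule m_le)
    also have "\<dots> \<le> card (S \<times> E B)"
      using S(1) covE[OF B] by (intro card_image_le) (auto simp: left_cover_def)
    also have "\<dots> \<le> M * card (E B)"
      using S(2) by (simp add: card_cartesian_product)
    finally show ?thesis .
  qed
  have "card \<B> * m = (\<Sum>B\<in>\<B>. m)"
    by simp
  also have "\<dots> \<le> (\<Sum>B\<in>\<B>. M * card (E B))"
    by (intro sum_mono big)
  also have "\<dots> = M * card (\<Union>B\<in>\<B>. E B)"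
  proof -
    have "card (\<Union>B\<in>\<B>. E B) = (\<Sum>B\<in>\<B>. card (E B))"
    proof (rule card_UN_disjoint[OF fin])
      show "\<forall>B\<in>\<B>. finite (E B)"
        using \<open>finite F\<close> by (simp add: E_def)
      show "\<forall>B\<in>\<B>. \<forall>B'\<in>\<B>. B \<noteq> B' \<longrightarrow> E B \<inter> E B' = {}"
        using sep F(1) unfolding E_def left_cover_def by blast
    qed
    then show ?thesis
      by (simp add: sum_distrib_left)
  qed
  also have "\<dots> \<le> M * m"
    using F(2) \<open>finite F\<close> by (intro mult_left_mono) (auto simp: E_def intro!: card_mono)
  finally show ?thesis
    using \<open>m > 0\<close> by simp
qed

end

context IN_group
begin

text \<open>The key to the kernel being closed under products. If \<open>k \<otimes> a\<close> were outside the closure of the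
invariant open set \<open>A\<close>, a whole piece \<open>a \<otimes> P\<close> of \<open>A\<close> would be moved out of \<open>A\<close> by every element
close to \<open>k\<close>, in particular by conjugates \<open>x \<otimes> u \<otimes> inv x\<close> with \<open>u\<close> as close to \<open>\<one>\<close> as desired.
Conjugating back, \<open>u\<close> moves the conjugate \<open>B\<close> of \<open>a \<otimes> P\<close> by \<open>inv x\<close> out of \<open>A\<close>. Since an element near \<open>\<one>\<close>
keeps any given compact subset of \<open>A\<close> inside \<open>A\<close>, such sets \<open>B\<close> can be chosen one after another to be
disjoint from all the previous ones. But as \<open>V\<close> is invariant, all of them cover \<open>V\<close> with the same
number of left translates as \<open>P\<close> does, and the packing bound is violated.\<close>

lemma IN_kernel_mult_open_invariant:
  assumes A: "openin T A" "invariant_subset G A" "A \<subseteq> V"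
    and V: "compactin T V" "invariant_subset G V"
    and k: "k \<in> IN_kernel G T" "k \<in> carrier G" and a: "a \<in> A"
  shows "k \<otimes> a \<in> T closure_of A"
proof (rule ccontr)
  assume nin: "k \<otimes> a \<notin> T closure_of A"
  have VG: "V \<subseteq> carrier G" and AG: "A \<subseteq> carrier G"
    using invariant_subset_carrier A V by auto
  then have aG: "a \<in> carrier G"
    using a by blast
  have cl: "openin T (carrier G - T closure_of A)"
    using topspace_eq_carrier by (metis closedin_closure_of closedin_def)
  have "continuous_map (prod_topology T T) T (\<lambda>p. fst p \<otimes> (a \<otimes> snd p))"
    using aG by (intro continuous_map_group_mult continuous_map_group_const continuous_map_fst
        continuous_map_snd)
  then have op: "openin (prod_topology T T)
      {p \<in> carrier G \<times> carrier G. fst p \<otimes> (a \<otimes> snd p) \<in> carrier G - T closure_of A}"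
    using openin_continuous_map_preimage[OF _ cl] by (fastforce simp: topspace_eq_carrier)
  have "(k, \<one>) \<in> {p \<in> carrier G \<times> carrier G. fst p \<otimes> (a \<otimes> snd p) \<in> carrier G - T closure_of A}"
    using k aG nin by simp
  then obtain Y U where YU: "openin T Y" "openin T U" "k \<in> Y" "\<one> \<in> U"
      "Y \<times> U \<subseteq> {p \<in> carrier G \<times> carrier G. fst p \<otimes> (a \<otimes> snd p) \<in> carrier G - T closure_of A}"
    using op unfolding openin_prod_topology_alt by meson
  define U' where "U' = U \<inter> {u \<in> carrier G. a \<otimes> u \<in> A}"
  have "openin T U'"
    unfolding U'_def using YU A aG
    by (intro openin_Int openin_group_preimage continuous_map_group_mult continuous_map_group_const)
      auto
  moreover have "\<one> \<in> U'"
    using YU a aG by (simp add: U'_def)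
  ultimately obtain P0 P where P: "openin T P0" "compactin T P" "\<one> \<in> P0" "P0 \<subseteq> P" "P \<subseteq> U'"
    using locally_compact Hausdorff locally_compact_space_neighbourhood_base[of T]
    unfolding neighbourhood_base_of by meson
  have PG: "P \<subseteq> carrier G"
    using P(2) compactin_subset_topspace topspace_eq_carrier by metis
  obtain F0 where "left_cover G F0 P0 V"
    using compact_left_cover[OF V(1) P(1,3)] .
  then have F0: "left_cover G F0 P V"
    using P(4) unfolding left_cover_def by blast
  \<comment> \<open>Nonemptiness makes disjoint members distinct, so that the cardinality of a family counts them.\<close>
  define good where "good B \<longleftrightarrow> compactin T B \<and> B \<noteq> {} \<and> B \<subseteq> A \<and>
      (\<exists>F. left_cover G F B V \<and> card F \<le> card F0)" for B
  have step: "\<exists>u B. u \<in> N \<and> good B \<and> (\<forall>b\<in>B. u \<otimes> b \<notin> A)" if N: "openin T N" "\<one> \<in> N" for N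
  proof -
    obtain u x where u: "u \<in> N" "x \<in> carrier G" "x \<otimes> u \<otimes> inv x \<in> Y"
      using IN_kernel_approx[OF k(1) YU(1,3) N] .
    have uG: "u \<in> carrier G"
      using u N openin_subset_carrier by blast
    define B where "B = (\<lambda>p. inv x \<otimes> (a \<otimes> p) \<otimes> x) ` P"
    have "continuous_map T T (\<lambda>p. inv x \<otimes> (a \<otimes> p) \<otimes> x)"
      using u(2) aG by (intro continuous_map_group_mult continuous_map_group_const) auto
    then have "compactin T B"
      unfolding B_def using P(2) image_compactin by blast
    moreover have "B \<noteq> {}"
      using P by (auto simp: B_def)
    moreover have "B \<subseteq> A"
    proof
      fix b assume "b \<in> B"
      then obtain p where "p \<in> P" "b = inv x \<otimes> (a \<otimes> p) \<otimes> x"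
        by (auto simp: B_def)
      moreover have "a \<otimes> p \<in> A"
        using \<open>p \<in> P\<close> P(5) by (auto simp: U'_def)
      ultimately show "b \<in> A"
        using invariant_subsetD'[OF A(2)] u(2) by auto
    qed
    moreover have "\<forall>b\<in>B. u \<otimes> b \<notin> A"
    proof
      fix b assume "b \<in> B"
      then obtain p where p: "p \<in> P" "b = inv x \<otimes> (a \<otimes> p) \<otimes> x"
        by (auto simp: B_def)
      have pG: "p \<in> carrier G" "p \<in> U"
        using p P PG by (auto simp: U'_def)
      show "u \<otimes> b \<notin> A"
      proof
        assume "u \<otimes> b \<in> A"
        then have "x \<otimes> (u \<otimes> b) \<otimes> inv x \<in> A"
          using invariant_subsetD[OF A(2)] u(2) by auto
        also have "x \<otimes> (u \<otimes> b) \<otimes> inv x = x \<otimes> u \<otimes> inv x \<otimes> (a \<otimes> p)"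
          using u(2) uG aG pG by (simp add: p m_assoc)
        finally have "x \<otimes> u \<otimes> inv x \<otimes> (a \<otimes> p) \<in> T closure_of A"
          using AG closure_of_subset topspace_eq_carrier by (metis subsetD)
        moreover have "(x \<otimes> u \<otimes> inv x, p) \<in> Y \<times> U"
          using u pG by auto
        ultimately show False
          using YU(5) by auto
      qed
    qed
    moreover have "\<exists>F. left_cover G F B V \<and> card F \<le> card F0"
    proof (intro exI conjI)
      let ?F = "(\<lambda>s. inv x \<otimes> s \<otimes> inv a \<otimes> x) ` F0"
      show "card ?F \<le> card F0"
        using F0 by (auto simp: left_cover_def intro: card_image_le)
      show "left_cover G ?F B V"
        unfolding left_cover_def
      proof (intro conjI ballI)
        fix v assume v: "v \<in> V"
        then have "x \<otimes> v \<otimes> inv x \<in> V"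
          using invariant_subsetD[OF V(2)] u(2) by auto
        then obtain s where s: "s \<in> F0" "inv s \<otimes> (x \<otimes> v \<otimes> inv x) \<in> P"
          using F0 by (auto simp: left_cover_def)
        have sG: "s \<in> carrier G" "v \<in> carrier G"
          using s F0 v VG by (auto simp: left_cover_def)
        have "inv (inv x \<otimes> s \<otimes> inv a \<otimes> x) \<otimes> v
            = inv x \<otimes> (a \<otimes> (inv s \<otimes> (x \<otimes> v \<otimes> inv x))) \<otimes> x"
          using u(2) sG aG by (simp add: inv_mult_group m_assoc)
        then show "\<exists>s\<in>?F. inv s \<otimes> v \<in> B"
          using s by (auto simp: B_def)
      qed (use F0 u(2) aG in \<open>auto simp: left_cover_def\<close>)
    qed
    ultimately show ?thesis
      using u(1) unfolding good_def by blast
  qed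
  have "\<exists>\<B>. finite \<B> \<and> card \<B> = n \<and> pairwise disjnt \<B> \<and> (\<forall>B\<in>\<B>. good B)" for n
  proof (induction n)
    case 0
    then show ?case
      by (intro exI[of _ "{}"]) auto
  next
    case (Suc n)
    then obtain \<B> where \<B>: "finite \<B>" "card \<B> = n" "pairwise disjnt \<B>" "\<And>B. B \<in> \<B> \<Longrightarrow> good B"
      by blast
    define D where "D = \<Union>\<B>"
    have D: "compactin T D" "D \<subseteq> A"
      unfolding D_def using \<B> by (auto simp: good_def intro!: compactin_Union)
    \<comment> \<open>By compactness of \<open>D\<close>, some neighborhood \<open>N\<close> of the identity satisfies \<open>N D \<subseteq> A\<close>.\<close>
    let ?P = "{p \<in> carrier G \<times> carrier G. fst p \<otimes> snd p \<in> A}"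
    have 1: "openin (prod_topology T T) ?P"
      using openin_continuous_map_preimage[OF continuous_mult A(1)]
      by (simp add: topspace_eq_carrier case_prod_unfold)
    have 2: "{\<one>} \<times> D \<subseteq> ?P"
      using D(2) AG by (auto simp: subset_iff)
    have 3: "compactin T {\<one>}"
      by (simp add: topspace_eq_carrier)
    obtain N N' where N: "openin T N" "openin T N'" "{\<one>} \<subseteq> N" "D \<subseteq> N'" "N \<times> N' \<subseteq> ?P"
      using Wallace_theorem_prod_topology[OF 3 D(1) 1 2] .
    then obtain u B where B: "u \<in> N" "good B" "\<forall>b\<in>B. u \<otimes> b \<notin> A"
      using step[of N] by auto
    have "B \<inter> D = {}"
      using B N by force
    then have "disjnt B C" if "C \<in> \<B>" for C
      using that by (auto simp: D_def disjnt_def)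
    moreover have "B \<notin> \<B>"
      using \<open>B \<inter> D = {}\<close> B(2) by (auto simp: D_def good_def)
    ultimately show ?case
      using \<B> B(2)
      by (intro exI[of _ "insert B \<B>"]) (auto simp: pairwise_insert disjnt_sym)
  qed
  then obtain \<B> where \<B>: "finite \<B>" "card \<B> = Suc (card F0)" "pairwise disjnt \<B>"
      "\<And>B. B \<in> \<B> \<Longrightarrow> good B"
    by meson
  have "card \<B> \<le> card F0"
  proof (rule card_disjoint_family_le[OF Hausdorff V(1) _ \<B>(1,3)])
    show "V \<noteq> {}"
      using a A by blast
  qed (use \<B>(4) A(3) in \<open>auto simp: good_def\<close>)
  then show False
    using \<B>(2) by simp
qed

text \<open>Products are the only difficult point. Given a closed invariant neighborhood \<open>C\<close>, apply the
previous lemma to the interior \<open>A\<close> of \<open>C \<inter> V\<close> with \<open>V\<close> compact and invariant: left translation by a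
kernel element \<open>k\<close> maps the closure of \<open>A\<close> into itself, and this closure contains the kernel.\<close>

lemma normal_IN_kernel: "IN_kernel G T \<lhd> G"
proof -
  obtain V where V: "invariant_nhd_one G T V" "compactin T V"
    using compact_invariant_nhd by blast
  let ?K = "IN_kernel G T"
  have K_iff: "k \<in> ?K \<longleftrightarrow> (\<forall>C. invariant_nhd_one G T C \<and> closedin T C \<longrightarrow> k \<in> C)" for k
    by (auto simp: IN_kernel_def)
  have "closedin T V"
    using Hausdorff V(2) compactin_imp_closedin by blast
  then have "?K \<subseteq> V"
    using V(1) K_iff by blast
  then have KG: "?K \<subseteq> carrier G"
    using V(1) by (auto simp: invariant_nhd_one_def invariant_subset_def)
  have one: "\<one> \<in> C" if "invariant_nhd_one G T C" for C
    using that interior_of_subset[of T C] by (auto simp: invariant_nhd_one_def)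
  have inv: "inv k \<in> ?K" if k: "k \<in> ?K" for k
    unfolding K_iff
  proof (intro allI impI)
    fix C assume C: "invariant_nhd_one G T C \<and> closedin T C"
    define D where "D = {x \<in> carrier G. inv x \<in> C}"
    have "closedin T D"
      unfolding D_def using C continuous_inv by (intro closedin_group_preimage) auto
    moreover have "invariant_nhd_one G T D"
      unfolding invariant_nhd_one_def
    proof
      show "invariant_subset G D"
      proof (rule invariant_subsetI)
        fix x a assume "x \<in> carrier G" "a \<in> D"
        then show "x \<otimes> a \<otimes> inv x \<in> D"
          using C invariant_subsetD[of C "inv a" x]
          by (auto simp: D_def invariant_nhd_one_def inv_mult_group m_assoc)
      qed (auto simp: D_def)
      have "openin T {x \<in> carrier G. inv x \<in> T interior_of C}"
        using continuous_inv by (intro openin_group_preimage) auto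
      moreover have "{x \<in> carrier G. inv x \<in> T interior_of C} \<subseteq> D"
        using interior_of_subset[of T C] by (auto simp: D_def)
      moreover have "\<one> \<in> {x \<in> carrier G. inv x \<in> T interior_of C}"
        using C by (simp add: invariant_nhd_one_def)
      ultimately show "\<one> \<in> T interior_of D"
        by (meson interior_of_maximal subsetD)
    qed
    ultimately have "k \<in> D"
      using k K_iff by blast
    then show "inv k \<in> C"
      by (simp add: D_def)
  qed
  have mult: "k \<otimes> l \<in> ?K" if k: "k \<in> ?K" and l: "l \<in> ?K" for k l
    unfolding K_iff
  proof (intro allI impI)
    fix C assume C: "invariant_nhd_one G T C \<and> closedin T C"
    have kG: "k \<in> carrier G"
      using k KG by blast
    have invCV: "invariant_subset G (C \<inter> V)"
    proof (rule invariant_subsetI)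
      show "C \<inter> V \<subseteq> carrier G"
        using C by (auto simp: invariant_nhd_one_def invariant_subset_def)
      show "x \<otimes> a \<otimes> inv x \<in> C \<inter> V" if "x \<in> carrier G" "a \<in> C \<inter> V" for x a
        using that invariant_subsetD C V by (auto simp: invariant_nhd_one_def)
    qed
    define A where "A = T interior_of (C \<inter> V)"
    have A: "openin T A" "invariant_subset G A" "A \<subseteq> V" "A \<subseteq> C"
      unfolding A_def using invariant_subset_interior_of[OF invCV] interior_of_subset[of T "C \<inter> V"]
      by auto
    have AG: "A \<subseteq> carrier G"
      using A invariant_subset_carrier by blast
    have "\<one> \<in> A"
      using C V by (simp add: A_def interior_of_Int invariant_nhd_one_def)
    have "A \<subseteq> T closure_of A"
      using AG by (simp add: closure_of_subset topspace_eq_carrier)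
    then have "invariant_nhd_one G T (T closure_of A)"
      using \<open>\<one> \<in> A\<close> A invariant_subset_closure_of interior_of_maximal[of A "T closure_of A" T]
      by (auto simp: invariant_nhd_one_def)
    then have "l \<in> T closure_of A"
      using l K_iff closedin_closure_of by blast
    moreover have "continuous_map T T (\<lambda>x. k \<otimes> x)"
      using kG by (intro continuous_map_group_mult continuous_map_group_const) auto
    ultimately have "k \<otimes> l \<in> T closure_of ((\<lambda>x. k \<otimes> x) ` A)"
      using continuous_map_image_closure_subset by fastforce
    moreover have "(\<lambda>x. k \<otimes> x) ` A \<subseteq> T closure_of A"
      using IN_kernel_mult_open_invariant[OF A(1-3) V(2) _ k kG] V(1)
      by (auto simp: invariant_nhd_one_def)
    ultimately have "k \<otimes> l \<in> T closure_of A"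
      by (meson closure_of_minimal closedin_closure_of subsetD)
    then show "k \<otimes> l \<in> C"
      using C A(4) by (meson closure_of_minimal subsetD)
  qed
  have "subgroup ?K G"
    using KG inv mult one K_iff[of \<one>] by (intro subgroupI) blast+
  moreover have "x \<otimes> k \<otimes> inv x \<in> ?K" if "x \<in> carrier G" "k \<in> ?K" for x k
    using that invariant_subsetD unfolding K_iff by (auto simp: invariant_nhd_one_def)
  ultimately show ?thesis
    by (simp add: normal_inv_iff)
qed

end

section \<open>The weak topology on bounded continuous functions\<close>

lemma bdd_cont_norm_le_sup_norm:
  assumes "f \<in> bdd_cont X" "t \<in> topspace X"
  shows "norm (f t) \<le> sup_norm X f"
proof -
  have "bdd_above ((\<lambda>x. norm (f x)) ` topspace X)"
    using assms(1) by (auto simp: bdd_cont_def bounded_iff bdd_above_def)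
  then show ?thesis
    unfolding sup_norm_def using assms(2) by (rule cSUP_upper2) simp
qed

lemma evaluation_in_bdd_cont_dual:
  assumes "t \<in> topspace X"
  shows "(\<lambda>f. f t) \<in> bdd_cont_dual X"
  using assms bdd_cont_norm_le_sup_norm[of _ X t]
  by (auto simp: bdd_cont_dual_def intro!: exI[of _ 1])

lemma continuous_map_weak_topology_dual:
  assumes "\<phi> \<in> bdd_cont_dual X"
  shows "continuous_map (weak_topology X) euclidean \<phi>"
  unfolding continuous_map_def
proof (intro conjI allI impI)
  fix U :: "complex set" assume "openin euclidean U"
  then have "openin (weak_topology X) {f \<in> bdd_cont X. \<phi> f \<in> U}"
    unfolding weak_topology_def using assms by (intro topology_generated_by_Basis) auto
  then show "openin (weak_topology X) {f \<in> topspace (weak_topology X). \<phi> f \<in> U}"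
    by simp
qed auto

lemma continuous_map_weak_topology_eval:
  "t \<in> topspace X \<Longrightarrow> continuous_map (weak_topology X) euclidean (\<lambda>f. f t)"
  by (intro continuous_map_weak_topology_dual evaluation_in_bdd_cont_dual)

lemma bdd_cont_eqI:
  assumes "f \<in> bdd_cont X" "g \<in> bdd_cont X" "\<And>t. t \<in> topspace X \<Longrightarrow> f t = g t"
  shows "f = g"
  using assms extensionalityI[of f "topspace X" g] by (simp add: bdd_cont_def)

text \<open>Point evaluations are bounded functionals and separate functions.\<close>

lemma Hausdorff_weak_topology: "Hausdorff_space (weak_topology X)"
  unfolding Hausdorff_space_def
proof (intro allI impI, elim conjE)
  fix f g assume f: "f \<in> topspace (weak_topology X)" and g: "g \<in> topspace (weak_topology X)"
    and "f \<noteq> g"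
  then obtain t where t: "t \<in> topspace X" "f t \<noteq> g t"
    using bdd_cont_eqI[of f X g] by auto
  then obtain U V where UV: "open U" "open V" "f t \<in> U" "g t \<in> V" "U \<inter> V = {}"
    using separation_t2[of "f t" "g t"] by auto
  let ?P = "\<lambda>U. {h \<in> topspace (weak_topology X). h t \<in> U}"
  have "openin (weak_topology X) (?P U)" "openin (weak_topology X) (?P V)"
    using UV continuous_map_weak_topology_eval[OF t(1)]
    by (auto intro!: openin_continuous_map_preimage simp del: topspace_weak_topology)
  then show "\<exists>U V. openin (weak_topology X) U \<and> openin (weak_topology X) V \<and> f \<in> U \<and> g \<in> V \<and> disjnt U V"
    using f g UV by (intro exI[of _ "?P U"] exI[of _ "?P V"]) (auto simp: disjnt_def)
qed

text \<open>As the weak topology is Hausdorff, relative weak compactness of \<open>S\<close> means no more than being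
contained in some weakly compact set.\<close>

lemma relatively_weakly_compactI:
  assumes C: "compactin (weak_topology X) C" and "S \<subseteq> C"
  shows "relatively_weakly_compact X S"
  unfolding relatively_weakly_compact_def
proof
  show "S \<subseteq> bdd_cont X"
    using assms compactin_subset_topspace by fastforce
  have "closedin (weak_topology X) C"
    using C Hausdorff_weak_topology compactin_imp_closedin by blast
  then have "weak_topology X closure_of S \<subseteq> C"
    using assms(2) by (simp add: closure_of_minimal)
  then show "compactin (weak_topology X) (weak_topology X closure_of S)"
    using C closed_compactin closedin_closure_of by blast
qed

section \<open>Weakly compact sets have small oscillation somewhere\<close>

lemma compactin_nest:
  fixes C :: "nat \<Rightarrow> 'a set"
  assumes "compactin X K" "\<And>n. closedin X (C n)" "\<And>n. C n \<inter> K \<noteq> {}" "decseq C"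
  obtains x where "x \<in> K" "\<And>n. x \<in> C n"
proof -
  have "(\<Inter>n. C n \<inter> K) \<noteq> {}"
  proof (rule compact_space_imp_nest)
    show "compact_space (subtopology X K)"
      using assms(1) by (simp add: compact_space_subtopology)
    show "closedin (subtopology X K) (C n \<inter> K)" for n
      using assms(2) closedin_subtopology by blast
    show "decseq (\<lambda>n. C n \<inter> K)"
      using assms(4) by (auto simp: decseq_def)
  qed (use assms(3) in auto)
  then show thesis
    using that by blast
qed

text \<open>A form of Namioka's theorem on separate and joint continuity, proved along the lines of
Christensen's topological game. Assume that the members of \<open>\<Phi>\<close> do not oscillate uniformly little on
any open subset of \<open>U0\<close>. Then for every finite set \<open>S\<close> there are two members of \<open>\<Phi>\<close> that nearly
agree on \<open>S\<close> but differ by more than \<open>\<eta>\<close> somewhere in a given open set: otherwise the finitely many classes of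
\<open>\<Phi>\<close> modulo near agreement on \<open>S\<close> would reduce the oscillation of all of \<open>\<Phi>\<close> to that of finitely
many continuous functions. Alternating between choosing points \<open>t n\<close> in shrinking open sets \<open>U n\<close> and
choosing pairs of functions that nearly agree at the earlier points but differ on
\<open>U (Suc n)\<close>, one obtains in the limit a pair in \<open>\<Phi>\<close> that agrees at all \<open>t n\<close> but
differs by at least \<open>\<eta>\<close> at a cluster point \<open>x\<close> of the \<open>t n\<close>. This contradicts the continuity of the two
functions.\<close>

lemma weakly_compact_small_oscillation:
  fixes X :: "'a topology"
  assumes \<Phi>: "compactin (weak_topology X) \<Phi>"
    and K: "compactin X K" and U0: "openin X U0" "U0 \<noteq> {}" "U0 \<subseteq> K" and "\<epsilon> > 0"
  obtains U where "openin X U" "U \<noteq> {}" "U \<subseteq> U0"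
    "\<And>\<phi> z w. \<lbrakk>\<phi> \<in> \<Phi>; z \<in> U; w \<in> U\<rbrakk> \<Longrightarrow> norm (\<phi> z - \<phi> w) \<le> \<epsilon>"
proof (rule ccontr)
  assume "\<not> thesis"
  note found = that
  have no: "\<exists>\<phi>\<in>\<Phi>. \<exists>z\<in>U. \<exists>w\<in>U. norm (\<phi> z - \<phi> w) > \<epsilon>"
    if "openin X U" "U \<noteq> {}" "U \<subseteq> U0" for U
    using found[OF that] \<open>\<not> thesis\<close> by (meson not_le)
  \<comment> \<open>Any member of \<open>\<Phi>\<close> is within \<open>\<eta>\<close> of one of finitely many functions that oscillate by at most \<open>\<eta>\<close>:
    this costs \<open>3 * \<eta>\<close>.\<close>
  define \<eta> where "\<eta> = \<epsilon> / 3"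
  have "\<eta> > 0"
    using \<open>\<epsilon> > 0\<close> by (simp add: \<eta>_def)
  have \<Phi>X: "\<Phi> \<subseteq> bdd_cont X"
    using \<Phi> compactin_subset_topspace by fastforce
  have cont: "continuous_map X euclidean \<phi>" if "\<phi> \<in> \<Phi>" for \<phi>
    using that \<Phi>X by (auto simp: bdd_cont_def)
  have step: "\<exists>\<phi>\<in>\<Phi>. \<exists>\<psi>\<in>\<Phi>. (\<forall>t\<in>S. norm (\<phi> t - \<psi> t) < \<delta>) \<and> (\<exists>z\<in>U. norm (\<phi> z - \<psi> z) > \<eta>)"
    if U: "openin X U" "U \<noteq> {}" "U \<subseteq> U0" and S: "finite S" "S \<subseteq> topspace X" and "\<delta> > 0"
    for U S and \<delta> :: real
  proof (rule ccontr)
    assume "\<not> ?thesis"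
    then have close: "norm (\<phi> z - \<psi> z) \<le> \<eta>"
      if "\<phi> \<in> \<Phi>" "\<psi> \<in> \<Phi>" "\<And>t. t \<in> S \<Longrightarrow> norm (\<phi> t - \<psi> t) < \<delta>" "z \<in> U" for \<phi> \<psi> z
      using that by (meson not_le)
    define N where "N \<psi> = \<Inter> (insert (bdd_cont X) ((\<lambda>t. {\<phi> \<in> bdd_cont X. norm (\<phi> t - \<psi> t) < \<delta>}) ` S))"
      for \<psi> :: "'a \<Rightarrow> complex"
    have opN: "openin (weak_topology X) (N \<psi>)" for \<psi>
      unfolding N_def
    proof (intro openin_Inter)
      fix A assume "A \<in> insert (bdd_cont X) ((\<lambda>t. {\<phi> \<in> bdd_cont X. norm (\<phi> t - \<psi> t) < \<delta>}) ` S)"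
      then consider "A = bdd_cont X" | t where "t \<in> S" "A = {\<phi> \<in> bdd_cont X. norm (\<phi> t - \<psi> t) < \<delta>}"
        by blast
      then show "openin (weak_topology X) A"
      proof cases
        case 1
        then show ?thesis
          using openin_topspace[of "weak_topology X"] by simp
      next
        case 2
        then have "t \<in> topspace X"
          using S by blast
        from openin_continuous_map_preimage[OF continuous_map_weak_topology_eval[OF this],
            of "ball (\<psi> t) \<delta>"]
        show ?thesis
          by (simp add: 2 dist_norm norm_minus_commute)
      qed
    qed (use S in auto)
    have "\<psi> \<in> N \<psi>" if "\<psi> \<in> \<Phi>" for \<psi>
      using that \<Phi>X \<open>\<delta> > 0\<close> by (auto simp: N_def)
    then have "\<Phi> \<subseteq> \<Union> (N ` \<Phi>)"
      by blast
    then obtain \<F> where "finite \<F>" "\<F> \<subseteq> N ` \<Phi>" "\<Phi> \<subseteq> \<Union>\<F>"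
      using compactinD[OF \<Phi>, of "N ` \<Phi>"] opN by blast
    then obtain D where D: "D \<subseteq> \<Phi>" "finite D" "\<Phi> \<subseteq> \<Union> (N ` D)"
      using finite_subset_image[of \<F> N \<Phi>] by auto
    obtain z0 where z0: "z0 \<in> U"
      using U by blast
    define U' where "U' = \<Inter> (insert U ((\<lambda>\<psi>. {z \<in> topspace X. norm (\<psi> z - \<psi> z0) < \<eta> / 2}) ` D))"
    have "openin X U'"
      unfolding U'_def
    proof (intro openin_Inter)
      fix A assume "A \<in> insert U ((\<lambda>\<psi>. {z \<in> topspace X. norm (\<psi> z - \<psi> z0) < \<eta> / 2}) ` D)"
      then consider "A = U" | \<psi> where "\<psi> \<in> D" "A = {z \<in> topspace X. norm (\<psi> z - \<psi> z0) < \<eta> / 2}"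
        by blast
      then show "openin X A"
      proof cases
        case 2
        then have "continuous_map X euclidean \<psi>"
          using cont D by blast
        from openin_continuous_map_preimage[OF this, of "ball (\<psi> z0) (\<eta> / 2)"]
        show ?thesis
          by (simp add: 2 dist_norm norm_minus_commute)
      qed (use U in simp)
    qed (use D in auto)
    moreover have "z0 \<in> U'"
      using z0 U(1) openin_subset[of X U] \<open>\<eta> > 0\<close> by (auto simp: U'_def)
    moreover have U'U: "U' \<subseteq> U"
      by (auto simp: U'_def)
    ultimately obtain \<phi> z w where *: "\<phi> \<in> \<Phi>" "z \<in> U'" "w \<in> U'" "norm (\<phi> z - \<phi> w) > \<epsilon>"
      using no[of U'] U(3) by blast
    then obtain \<psi> where \<psi>: "\<psi> \<in> D" "\<phi> \<in> N \<psi>"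
      using D(3) by blast
    then have near: "norm (\<phi> v - \<psi> v) \<le> \<eta>" if "v \<in> U" for v
      using that D(1) *(1) by (intro close) (auto simp: N_def)
    have osc: "norm (\<psi> v - \<psi> z0) < \<eta> / 2" if "v \<in> U'" for v
      using that \<psi>(1) by (auto simp: U'_def)
    have "\<phi> z - \<phi> w = (\<phi> z - \<psi> z) + (\<psi> z - \<psi> z0) - (\<psi> w - \<psi> z0) - (\<phi> w - \<psi> w)"
      by simp
    also have "norm \<dots> \<le> norm (\<phi> z - \<psi> z) + norm (\<psi> z - \<psi> z0) + norm (\<psi> w - \<psi> z0) + norm (\<phi> w - \<psi> w)"
      by (meson add_mono norm_triangle_ineq norm_triangle_ineq4 order_refl order_trans)
    also have "\<dots> \<le> \<eta> + \<eta> / 2 + \<eta> / 2 + \<eta>"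
      using near osc * U'U by (intro add_mono) (auto intro: less_imp_le)
    also have "\<dots> = \<epsilon>"
      by (simp add: \<eta>_def)
    finally show False
      using *(4) by simp
  qed
  \<comment> \<open>The states of the game are pairs \<open>(U, S)\<close> of the current open set and the finite set of points
    chosen so far.\<close>
  define P where "P p \<longleftrightarrow> openin X (fst p) \<and> fst p \<noteq> {} \<and> fst p \<subseteq> U0 \<and> finite (snd p) \<and>
      snd p \<subseteq> topspace X" for p :: "'a set \<times> 'a set"
  define Q where "Q n p p' \<longleftrightarrow> fst p' \<subseteq> fst p \<and> snd p \<subseteq> snd p' \<and> snd p' \<inter> fst p \<noteq> {} \<and>
      (\<exists>\<phi>\<in>\<Phi>. \<exists>\<psi>\<in>\<Phi>. (\<forall>t\<in>snd p. norm (\<phi> t - \<psi> t) < 1 / (real n + 1)) \<and>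
         (\<forall>z\<in>fst p'. norm (\<phi> z - \<psi> z) > \<eta>))" for n and p p' :: "'a set \<times> 'a set"
  have "\<exists>f. \<forall>n. P (f n) \<and> Q n (f n) (f (Suc n))"
  proof (rule dependent_nat_choice)
    show "\<exists>p. P p"
      using U0 by (intro exI[of _ "(U0, {})"]) (auto simp: P_def)
    fix p n assume "P p"
    then have p: "openin X (fst p)" "fst p \<noteq> {}" "fst p \<subseteq> U0" "finite (snd p)" "snd p \<subseteq> topspace X"
      by (auto simp: P_def)
    obtain \<phi> \<psi> z where *: "\<phi> \<in> \<Phi>" "\<psi> \<in> \<Phi>" "\<forall>t\<in>snd p. norm (\<phi> t - \<psi> t) < 1 / (real n + 1)"
        "z \<in> fst p" "norm (\<phi> z - \<psi> z) > \<eta>"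
      using step[OF p, of "1 / (real n + 1)"] by auto
    define U where "U = fst p \<inter> {z \<in> topspace X. norm (\<phi> z - \<psi> z) > \<eta>}"
    have "continuous_map X euclidean (\<lambda>z. norm (\<phi> z - \<psi> z))"
      using * by (intro continuous_map_norm continuous_map_diff cont)
    from openin_continuous_map_preimage[OF this, of "{\<eta><..}"]
    have "openin X U"
      using p(1) by (auto simp: U_def)
    moreover have zX: "z \<in> topspace X"
      using *(4) p(1) openin_subset by blast
    ultimately show "\<exists>p'. P p' \<and> Q n p p'"
      using * p by (intro exI[of _ "(U, insert z (snd p))"]) (auto simp: P_def Q_def U_def)
  qed
  then obtain f where P: "\<And>n. P (f n)" and Q: "\<And>n. Q n (f n) (f (Suc n))"
    by blast
  define U where "U n = fst (f n)" for n
  define S where "S n = snd (f n)" for n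
  have "\<forall>n. \<exists>t. t \<in> S (Suc n) \<inter> U n"
    using Q unfolding Q_def U_def S_def by blast
  then obtain t where t: "\<And>n. t n \<in> S (Suc n)" "\<And>n. t n \<in> U n"
    by (metis IntE)
  have "\<forall>n. \<exists>\<phi>\<psi>. fst \<phi>\<psi> \<in> \<Phi> \<and> snd \<phi>\<psi> \<in> \<Phi> \<and>
      (\<forall>s\<in>S n. norm (fst \<phi>\<psi> s - snd \<phi>\<psi> s) < 1 / (real n + 1)) \<and>
      (\<forall>z\<in>U (Suc n). norm (fst \<phi>\<psi> z - snd \<phi>\<psi> z) > \<eta>)"
    using Q unfolding Q_def U_def S_def by (metis fst_conv snd_conv)
  then obtain \<phi>\<psi> where \<phi>\<psi>: "\<And>n. fst (\<phi>\<psi> n) \<in> \<Phi>" "\<And>n. snd (\<phi>\<psi> n) \<in> \<Phi>"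
      "\<And>n s. s \<in> S n \<Longrightarrow> norm (fst (\<phi>\<psi> n) s - snd (\<phi>\<psi> n) s) < 1 / (real n + 1)"
      "\<And>n z. z \<in> U (Suc n) \<Longrightarrow> norm (fst (\<phi>\<psi> n) z - snd (\<phi>\<psi> n) z) > \<eta>"
    by metis
  have "decseq U"
    using Q by (auto simp: decseq_Suc_iff Q_def U_def)
  have "incseq S"
    using Q by (auto simp: incseq_Suc_iff Q_def S_def)
  have UX: "U n \<subseteq> U0" "U n \<subseteq> topspace X" for n
    using P[of n] openin_subset by (auto simp: P_def U_def)
  have tX: "t i \<in> topspace X" for i
    using t(2) UX by blast
  obtain x where x: "\<And>n. x \<in> X closure_of (t ` {n..})"
  proof (rule compactin_nest[OF K, of "\<lambda>n. X closure_of (t ` {n..})"])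
    show "X closure_of t ` {n..} \<inter> K \<noteq> {}" for n
    proof -
      have "t n \<in> X closure_of (t ` {n..})"
        using closure_of_subset[of "t ` {n..}" X] tX by (simp add: image_subset_iff)
      moreover have "t n \<in> K"
        using t(2) UX U0(3) by blast
      ultimately show ?thesis
        by blast
    qed
    show "decseq (\<lambda>n. X closure_of t ` {n..})"
      by (auto simp: decseq_def intro!: closure_of_mono)
  qed auto
  have xX: "x \<in> topspace X"
    using x[of 0] by (simp add: in_closure_of)
  have lim: "x \<in> C" if "closedin X C" "\<And>m. m \<ge> n \<Longrightarrow> t m \<in> C" for C n
    using that x[of n] closure_of_minimal[of "t ` {n..}" C X] by blast
  have far: "norm (fst (\<phi>\<psi> n) x - snd (\<phi>\<psi> n) x) \<ge> \<eta>" for n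
  proof -
    have "continuous_map X euclidean (\<lambda>z. norm (fst (\<phi>\<psi> n) z - snd (\<phi>\<psi> n) z))"
      using \<phi>\<psi> by (intro continuous_map_norm continuous_map_diff cont)
    from closedin_continuous_map_preimage[OF this, of "{\<eta>..}"]
    have "x \<in> {z \<in> topspace X. norm (fst (\<phi>\<psi> n) z - snd (\<phi>\<psi> n) z) \<in> {\<eta>..}}"
    proof (rule lim[where n="Suc n"])
      fix m assume "m \<ge> Suc n"
      then have "t m \<in> U (Suc n)"
        using t(2) \<open>decseq U\<close> by (auto dest: decseqD)
      then show "t m \<in> {z \<in> topspace X. norm (fst (\<phi>\<psi> n) z - snd (\<phi>\<psi> n) z) \<in> {\<eta>..}}"
        using \<phi>\<psi>(4) UX by (force intro: less_imp_le)
    qed simp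
    then show ?thesis
      by simp
  qed
  let ?W = "weak_topology X"
  have contd: "continuous_map (prod_topology ?W ?W) euclidean (\<lambda>p. norm (fst p s - snd p s))"
    if "s \<in> topspace X" for s
  proof -
    have "continuous_map (prod_topology ?W ?W) euclidean (\<lambda>p. fst p s)"
      using continuous_map_compose[OF continuous_map_fst continuous_map_weak_topology_eval[OF that]]
      by (simp add: o_def)
    moreover have "continuous_map (prod_topology ?W ?W) euclidean (\<lambda>p. snd p s)"
      using continuous_map_compose[OF continuous_map_snd continuous_map_weak_topology_eval[OF that]]
      by (simp add: o_def)
    ultimately show ?thesis
      by (intro continuous_map_norm continuous_map_diff)
  qed
  define D where "D s r = {p \<in> topspace (prod_topology ?W ?W). norm (fst p s - snd p s) \<in> r}"
    for s and r :: "real set"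
  have clD: "closedin (prod_topology ?W ?W) (D s r)" if "s \<in> topspace X" "closed r" for s r
    unfolding D_def using that by (intro closedin_continuous_map_preimage[OF contd]) auto
  \<comment> \<open>The conditions on the limit pair are closed in the product of the weak topology with itself,
    and the \<open>n\<close>-th pair satisfies the first \<open>n\<close> of them.\<close>
  define C where "C n = \<Inter> (insert (D x {\<eta>..}) ((\<lambda>i. D (t i) {..1 / (real n + 1)}) ` {..<n}))" for n
  have memC: "p \<in> C n \<longleftrightarrow> p \<in> D x {\<eta>..} \<and> (\<forall>i<n. p \<in> D (t i) {..1 / (real n + 1)})" for p n
    by (auto simp: C_def)
  obtain p where p: "p \<in> \<Phi> \<times> \<Phi>" "\<And>n. p \<in> C n"
  proof (rule compactin_nest[of "prod_topology ?W ?W" "\<Phi> \<times> \<Phi>" C])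
    show "compactin (prod_topology ?W ?W) (\<Phi> \<times> \<Phi>)"
      using \<Phi> by (simp add: compactin_Times)
    show "closedin (prod_topology ?W ?W) (C n)" for n
      unfolding C_def using clD xX tX by (intro closedin_Inter) auto
    show "C n \<inter> \<Phi> \<times> \<Phi> \<noteq> {}" for n
    proof -
      have "norm (fst (\<phi>\<psi> n) (t i) - snd (\<phi>\<psi> n) (t i)) \<le> 1 / (real n + 1)" if "i < n" for i
      proof -
        have "t i \<in> S n"
          using t(1)[of i] \<open>incseq S\<close> that by (auto dest!: incseqD[of S "Suc i" n])
        then show ?thesis
          using \<phi>\<psi>(3) less_imp_le by blast
      qed
      then have "\<phi>\<psi> n \<in> C n"
        using far \<phi>\<psi>(1,2) \<Phi>X by (auto simp: C_def D_def mem_Times_iff)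
      moreover have "\<phi>\<psi> n \<in> \<Phi> \<times> \<Phi>"
        using \<phi>\<psi>(1,2) by (simp add: mem_Times_iff)
      ultimately show ?thesis
        unfolding disjoint_iff by metis
    qed
    show "decseq C"
      unfolding decseq_Suc_iff
    proof
      fix n
      have "1 / (real (Suc n) + 1) \<le> 1 / (real n + 1)"
        by (simp add: field_simps)
      then have "D s {..1 / (real (Suc n) + 1)} \<subseteq> D s {..1 / (real n + 1)}" for s
        unfolding D_def by (auto intro: order_trans)
      then show "C (Suc n) \<subseteq> C n"
        unfolding subset_iff memC by (meson less_SucI)
    qed
  qed (rule that)
  have eq: "fst p (t i) = snd p (t i)" for i
  proof -
    have "norm (fst p (t i) - snd p (t i)) \<le> 0"
    proof (rule LIMSEQ_le_const)
      show "(\<lambda>n. 1 / (real n + 1)) \<longlonglongrightarrow> 0"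
        using LIMSEQ_inverse_real_of_nat by (simp add: inverse_eq_divide add.commute)
      show "\<exists>N. \<forall>n\<ge>N. norm (fst p (t i) - snd p (t i)) \<le> 1 / (real n + 1)"
      proof (intro exI allI impI)
        fix n assume "n \<ge> Suc i"
        then show "norm (fst p (t i) - snd p (t i)) \<le> 1 / (real n + 1)"
          using p(2)[of n] by (auto simp: C_def D_def)
      qed
    qed
    then show ?thesis
      by simp
  qed
  have "continuous_map X euclidean (\<lambda>z. fst p z - snd p z)"
    using p(1) by (intro continuous_map_diff cont) auto
  from closedin_continuous_map_preimage[OF this, of "{0}"]
  have "x \<in> {z \<in> topspace X. fst p z - snd p z \<in> {0}}"
    by (rule lim) (use eq tX in auto)
  moreover have "norm (fst p x - snd p x) \<ge> \<eta>"
    using p(2)[of 0] by (simp add: C_def D_def)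
  ultimately show False
    using \<open>\<eta> > 0\<close> by simp
qed

section \<open>Functions with relatively weakly compact double orbit are constant on cosets of the kernel\<close>

context locally_compact_group
begin

text \<open>A double orbit is stable under translations, so a point \<open>z0\<close> around which it oscillates little
may be moved to the identity: the factor \<open>b\<close> on the right absorbs \<open>inv z0\<close>.\<close>

lemma WS_two_sided_equicontinuous:
  assumes f: "f \<in> WS G T" and "\<epsilon> > 0"
  obtains W where "openin T W" "\<one> \<in> W"
    "\<And>u a b. \<lbrakk>u \<in> W; a \<in> carrier G; b \<in> carrier G\<rbrakk> \<Longrightarrow> norm (f (a \<otimes> u \<otimes> b) - f (a \<otimes> b)) \<le> \<epsilon>"
proof -
  define \<Phi> where "\<Phi> = weak_topology T closure_of double_orbit G f"
  have \<Phi>: "compactin (weak_topology T) \<Phi>" and sub: "double_orbit G f \<subseteq> \<Phi>"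
    using f closure_of_subset[of "double_orbit G f" "weak_topology T"]
    by (auto simp: WS_def relatively_weakly_compact_def \<Phi>_def)
  obtain U0 K where U0: "openin T U0" "compactin T K" "\<one> \<in> U0" "U0 \<subseteq> K"
    using locally_compact one_closed unfolding locally_compact_space_def topspace_eq_carrier by blast
  then have ne: "U0 \<noteq> {}"
    by blast
  obtain U where U: "openin T U" "U \<noteq> {}" "U \<subseteq> U0"
      "\<And>\<phi> z w. \<lbrakk>\<phi> \<in> \<Phi>; z \<in> U; w \<in> U\<rbrakk> \<Longrightarrow> norm (\<phi> z - \<phi> w) \<le> \<epsilon>"
    using weakly_compact_small_oscillation[OF \<Phi> U0(2,1) ne U0(4) \<open>\<epsilon> > 0\<close>] by metis
  obtain z0 where z0: "z0 \<in> U"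
    using U by blast
  then have z0G: "z0 \<in> carrier G"
    using U(1) openin_subset_carrier by blast
  define W where "W = {u \<in> carrier G. u \<otimes> z0 \<in> U}"
  show thesis
  proof
    show "openin T W"
      unfolding W_def using U(1) z0G
      by (intro openin_group_preimage continuous_map_group_mult continuous_map_group_const) auto
    show "\<one> \<in> W"
      using z0 z0G by (simp add: W_def)
    fix u a b assume *: "u \<in> W" "a \<in> carrier G" "b \<in> carrier G"
    let ?\<phi> = "\<lambda>z\<in>carrier G. f (a \<otimes> z \<otimes> (inv z0 \<otimes> b))"
    have "?\<phi> \<in> double_orbit G f"
      unfolding double_orbit_def using * z0G by blast
    from U(4)[OF subsetD[OF sub this], of "u \<otimes> z0" z0]
    have "norm (?\<phi> (u \<otimes> z0) - ?\<phi> z0) \<le> \<epsilon>"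
      using z0 * by (simp add: W_def)
    moreover have "?\<phi> (u \<otimes> z0) = f (a \<otimes> u \<otimes> b)" "?\<phi> z0 = f (a \<otimes> b)"
      using * z0G by (auto simp: W_def m_assoc)
    ultimately show "norm (f (a \<otimes> u \<otimes> b) - f (a \<otimes> b)) \<le> \<epsilon>"
      by simp
  qed
qed

text \<open>Taking \<open>a = x\<close> and \<open>b = inv x \<otimes> z\<close> in the two-sided equicontinuity, the elements \<open>c\<close> all of whose
conjugates move the value at \<open>z\<close> by at most \<open>\<epsilon>\<close> form a closed invariant neighborhood of \<open>\<one>\<close>, which
therefore contains the kernel.\<close>

lemma WS_IN_kernel_invariant:
  assumes f: "f \<in> WS G T" and k: "k \<in> IN_kernel G T" and z: "z \<in> carrier G"
  shows "f (k \<otimes> z) = f z"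
proof (rule ccontr)
  assume "f (k \<otimes> z) \<noteq> f z"
  define \<epsilon> where "\<epsilon> = norm (f (k \<otimes> z) - f z) / 2"
  have "\<epsilon> > 0"
    using \<open>f (k \<otimes> z) \<noteq> f z\<close> by (simp add: \<epsilon>_def)
  obtain W where W: "openin T W" "\<one> \<in> W"
    "\<And>u a b. \<lbrakk>u \<in> W; a \<in> carrier G; b \<in> carrier G\<rbrakk> \<Longrightarrow> norm (f (a \<otimes> u \<otimes> b) - f (a \<otimes> b)) \<le> \<epsilon>"
    using WS_two_sided_equicontinuous[OF f \<open>\<epsilon> > 0\<close>] by metis
  have WG: "W \<subseteq> carrier G"
    using W(1) openin_subset_carrier by blast
  define C where "C = (\<Inter>x\<in>carrier G.
    {c \<in> carrier G. norm (f (x \<otimes> c \<otimes> inv x \<otimes> z) - f z) \<in> {..\<epsilon>}})"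
  have memC: "c \<in> C \<longleftrightarrow> c \<in> carrier G \<and>
      (\<forall>x\<in>carrier G. norm (f (x \<otimes> c \<otimes> inv x \<otimes> z) - f z) \<le> \<epsilon>)" for c
    using one_closed unfolding C_def by blast
  have "closedin T C"
    unfolding C_def
  proof (intro closedin_Inter)
    fix A assume "A \<in> (\<lambda>x. {c \<in> carrier G. norm (f (x \<otimes> c \<otimes> inv x \<otimes> z) - f z) \<in> {..\<epsilon>}}) ` carrier G"
    then obtain x where x: "x \<in> carrier G"
      and A: "A = {c \<in> carrier G. norm (f (x \<otimes> c \<otimes> inv x \<otimes> z) - f z) \<in> {..\<epsilon>}}"
      by blast
    have "continuous_map T T (\<lambda>c. x \<otimes> c \<otimes> inv x \<otimes> z)"
      using x z by (intro continuous_map_group_mult continuous_map_group_const) auto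
    from continuous_map_compose[OF this, of euclidean f]
    have "continuous_map T euclidean (\<lambda>c. f (x \<otimes> c \<otimes> inv x \<otimes> z))"
      using f by (simp add: o_def WS_def bdd_cont_def)
    then have "continuous_map T euclidean (\<lambda>c. norm (f (x \<otimes> c \<otimes> inv x \<otimes> z) - f z))"
      by (intro continuous_map_norm continuous_map_diff) auto
    from closedin_continuous_map_preimage[OF this, of "{..\<epsilon>}"]
    show "closedin T A"
      by (simp add: A topspace_eq_carrier)
  qed (use one_closed in blast)
  moreover have "invariant_nhd_one G T C"
    unfolding invariant_nhd_one_def
  proof
    show "invariant_subset G C"
    proof (rule invariant_subsetI)
      show "C \<subseteq> carrier G"
        using memC by blast
      fix g c assume g: "g \<in> carrier G" and c: "c \<in> C"
      then have cG: "c \<in> carrier G"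
        by (simp add: memC)
      have "norm (f (x \<otimes> (g \<otimes> c \<otimes> inv g) \<otimes> inv x \<otimes> z) - f z) \<le> \<epsilon>" if x: "x \<in> carrier G" for x
      proof -
        have "x \<otimes> (g \<otimes> c \<otimes> inv g) \<otimes> inv x \<otimes> z = (x \<otimes> g) \<otimes> c \<otimes> inv (x \<otimes> g) \<otimes> z"
          using x g cG z by (simp add: m_assoc inv_mult_group)
        then show ?thesis
          using c x g by (simp add: memC)
      qed
      then show "g \<otimes> c \<otimes> inv g \<in> C"
        using g cG by (simp add: memC)
    qed
    have "W \<subseteq> C"
    proof
      fix u assume u: "u \<in> W"
      have "norm (f (x \<otimes> u \<otimes> inv x \<otimes> z) - f z) \<le> \<epsilon>" if x: "x \<in> carrier G" for x
        using W(3)[OF u x, of "inv x \<otimes> z"] x z u WG by (simp add: m_assoc subset_iff)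
      then show "u \<in> C"
        using u WG by (auto simp: memC)
    qed
    then show "\<one> \<in> T interior_of C"
      using W(1,2) interior_of_maximal by blast
  qed
  ultimately have "k \<in> C"
    using k by (auto simp: IN_kernel_def)
  then have kG: "k \<in> carrier G" and "norm (f (\<one> \<otimes> k \<otimes> inv \<one> \<otimes> z) - f z) \<le> \<epsilon>"
    using one_closed unfolding memC by blast+
  then have "norm (f (k \<otimes> z) - f z) \<le> \<epsilon>"
    by simp
  then show False
    using \<open>\<epsilon> > 0\<close> by (simp add: \<epsilon>_def)
qed

end

section \<open>Extension of linear functionals\<close>

text \<open>The Hahn--Banach theorem, stated for graphs: a partial linear functional is a subspace of
\<open>V \<times> \<real>\<close>. Domination by \<open>p\<close> already makes such a subspace single-valued, because \<open>(0, r)\<close> and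
\<open>(0, - r)\<close> both lie in it if one does. Thus neither Zorn's lemma nor the applications need to
treat well-definedness separately.\<close>

lemma Hahn_Banach_graph:
  fixes p :: "'v::real_vector \<Rightarrow> real" and g :: "('v \<times> real) set"
  assumes p_add: "\<And>x y. p (x + y) \<le> p x + p y"
    and p_scale: "\<And>t x. t > 0 \<Longrightarrow> p (t *\<^sub>R x) = t * p x"
    and g: "subspace g" "\<And>v r. (v, r) \<in> g \<Longrightarrow> r \<le> p v"
  obtains U where "linear U" "\<And>v r. (v, r) \<in> g \<Longrightarrow> U v = r" "\<And>v. U v \<le> p v"
proof -
  define \<S> where "\<S> = {h. subspace h \<and> g \<subseteq> h \<and> (\<forall>(v, r)\<in>h. r \<le> p v)}"
  have "\<exists>M\<in>\<S>. \<forall>h\<in>\<S>. M \<subseteq> h \<longrightarrow> h = M"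
  proof (rule subset_Zorn_nonempty)
    show "\<S> \<noteq> {}"
      using g by (auto simp: \<S>_def)
    fix \<C> assume \<C>: "\<C> \<noteq> {}" "subset.chain \<S> \<C>"
    then have sub: "\<C> \<subseteq> \<S>" and chain: "\<And>h h'. \<lbrakk>h \<in> \<C>; h' \<in> \<C>\<rbrakk> \<Longrightarrow> h \<subseteq> h' \<or> h' \<subseteq> h"
      by (auto simp: subset_chain_def)
    have "subspace (\<Union>\<C>)"
    proof (rule subspaceI)
      show "0 \<in> \<Union>\<C>"
        using \<C>(1) sub subspace_0 by (fastforce simp: \<S>_def)
      show "x + y \<in> \<Union>\<C>" if "x \<in> \<Union>\<C>" "y \<in> \<Union>\<C>" for x y
      proof -
        from that obtain h h' where "h \<in> \<C>" "h' \<in> \<C>" "x \<in> h" "y \<in> h'"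
          by blast
        then obtain k where "k \<in> \<C>" "x \<in> k" "y \<in> k"
          using chain[of h h'] by blast
        then show ?thesis
          using sub subspace_add[of k x y] by (auto simp: \<S>_def)
      qed
      show "c *\<^sub>R x \<in> \<Union>\<C>" if "x \<in> \<Union>\<C>" for c x
        using that sub subspace_scale unfolding \<S>_def by blast
    qed
    then show "\<Union>\<C> \<in> \<S>"
      using \<C>(1) sub by (fastforce simp: \<S>_def)
  qed
  then obtain M where MS: "M \<in> \<S>" and max: "\<And>h. \<lbrakk>h \<in> \<S>; M \<subseteq> h\<rbrakk> \<Longrightarrow> h = M"
    by blast
  then have M: "subspace M" "g \<subseteq> M" and Mp: "\<And>v r. (v, r) \<in> M \<Longrightarrow> r \<le> p v"
    by (auto simp: \<S>_def)
  have p0: "p 0 = 0"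
    using p_scale[of 2 0] by simp
  have unique: "r = r'" if "(v, r) \<in> M" "(v, r') \<in> M" for v r r'
    using Mp[of 0 "r - r'"] Mp[of 0 "r' - r"] that
      subspace_diff[OF M(1), of "(v, r)" "(v, r')"] subspace_diff[OF M(1), of "(v, r')" "(v, r)"]
    by (simp add: p0)
  have total: "\<exists>r. (v\<^sub>0, r) \<in> M" for v\<^sub>0
  proof -
    have M0: "(0, 0) \<in> M"
      using subspace_0[OF M(1)] by (simp add: zero_prod_def)
    have key: "s - p (w - v\<^sub>0) \<le> p (w' + v\<^sub>0) - s'" if "(w, s) \<in> M" "(w', s') \<in> M" for w s w' s'
      using Mp[of "w + w'" "s + s'"] subspace_add[OF M(1) that] p_add[of "w - v\<^sub>0" "w' + v\<^sub>0"]
      by (simp add: algebra_simps)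
    \<comment> \<open>Any value between the lower and the upper bounds in \<open>key\<close> extends \<open>M\<close> to \<open>v\<^sub>0\<close>.\<close>
    define a where "a = (SUP (w, s)\<in>M. s - p (w - v\<^sub>0))"
    have lower: "s - p (w - v\<^sub>0) \<le> a" if "(w, s) \<in> M" for w s
    proof -
      have "bdd_above ((\<lambda>(w, s). s - p (w - v\<^sub>0)) ` M)"
        using key[OF _ M0] by (intro bdd_aboveI2[where M="p v\<^sub>0"]) auto
      from cSUP_upper[OF that this] show ?thesis
        by (simp add: a_def)
    qed
    have upper: "a \<le> p (w + v\<^sub>0) - s" if "(w, s) \<in> M" for w s
      unfolding a_def using key[OF _ that] M0 by (intro cSUP_least) (auto simp del: le_diff_eq)
    have "span (insert (v\<^sub>0, a) M) \<in> \<S>"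
      unfolding \<S>_def
    proof (intro CollectI conjI ballI)
      show "subspace (span (insert (v\<^sub>0, a) M))"
        by simp
      show "g \<subseteq> span (insert (v\<^sub>0, a) M)"
        using M(2) span_superset by fast
      fix x assume "x \<in> span (insert (v\<^sub>0, a) M)"
      moreover have "span M = M"
        using M(1) by simp
      ultimately obtain k where k: "x - k *\<^sub>R (v\<^sub>0, a) \<in> M"
        by (auto simp: span_insert)
      obtain v r where x: "x = (v, r)"
        by force
      have kM: "(v - k *\<^sub>R v\<^sub>0, r - k * a) \<in> M"
        using k by (simp add: x)
      consider "k = 0" | "k > 0" | "k < 0"
        by linarith
      then have "r \<le> p v"
      proof cases
        case 1
        then show ?thesis
          using kM Mp by simp
      next
        case 2
        have "((1/k) *\<^sub>R (v - k *\<^sub>R v\<^sub>0), (1/k) * (r - k * a)) \<in> M"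
          using subspace_scale[OF M(1) kM, of "1/k"] by simp
        from upper[OF this] have "k * a \<le> k * p ((1/k) *\<^sub>R (v - k *\<^sub>R v\<^sub>0) + v\<^sub>0) - (r - k * a)"
          using 2 by (simp add: field_simps)
        also have "k * p ((1/k) *\<^sub>R (v - k *\<^sub>R v\<^sub>0) + v\<^sub>0) = p v"
          using 2 p_scale[of k "(1/k) *\<^sub>R (v - k *\<^sub>R v\<^sub>0) + v\<^sub>0"] by (simp add: algebra_simps)
        finally show ?thesis
          by simp
      next
        case 3
        define j where "j = - k"
        have j: "j > 0" "(v + j *\<^sub>R v\<^sub>0, r + j * a) \<in> M"
          using 3 kM by (auto simp: j_def)
        have "((1/j) *\<^sub>R (v + j *\<^sub>R v\<^sub>0), (1/j) * (r + j * a)) \<in> M"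
          using subspace_scale[OF M(1) j(2), of "1/j"] by simp
        from lower[OF this] have "r + j * a - j * p ((1/j) *\<^sub>R (v + j *\<^sub>R v\<^sub>0) - v\<^sub>0) \<le> j * a"
          using j(1) by (simp add: field_simps)
        moreover have "j * p ((1/j) *\<^sub>R (v + j *\<^sub>R v\<^sub>0) - v\<^sub>0) = p v"
          using j(1) p_scale[of j "(1/j) *\<^sub>R (v + j *\<^sub>R v\<^sub>0) - v\<^sub>0"] by (simp add: algebra_simps)
        ultimately show ?thesis
          by simp
      qed
      then show "case x of (v, r) \<Rightarrow> r \<le> p v"
        by (simp add: x)
    qed
    moreover have "M \<subseteq> span (insert (v\<^sub>0, a) M)"
      using span_superset by fast
    ultimately have "span (insert (v\<^sub>0, a) M) = M"
      by (rule max)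
    then have "(v\<^sub>0, a) \<in> M"
      using span_base[of "(v\<^sub>0, a)" "insert (v\<^sub>0, a) M"] by simp
    then show ?thesis ..
  qed
  then obtain U where U: "\<And>v. (v, U v) \<in> M"
    by metis
  show thesis
  proof
    show "linear U"
    proof (rule linearI)
      show "U (x + y) = U x + U y" for x y
        using unique[OF U] subspace_add[OF M(1) U[of x] U[of y]] by simp
      show "U (c *\<^sub>R x) = c *\<^sub>R U x" for c x
        using unique[OF U] subspace_scale[OF M(1) U[of x], of c] by simp
    qed
    show "U v = r" if "(v, r) \<in> g" for v r
      using that M(2) unique[OF U] by blast
    show "U v \<le> p v" for v
      using U Mp by blast
  qed
qed

section \<open>Weak compactness and quotient maps\<close>

lemma restrict_in_bdd_cont:
  assumes "continuous_map X euclidean f" "bounded (f ` topspace X)"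
  shows "(\<lambda>x\<in>topspace X. f x) \<in> bdd_cont X"
proof -
  have "continuous_map X euclidean (\<lambda>x\<in>topspace X. f x)"
    using assms(1) by (rule continuous_map_eq) simp
  then show ?thesis
    using assms(2) by (simp add: bdd_cont_def)
qed

lemma bdd_cont_add:
  assumes "f \<in> bdd_cont X" "g \<in> bdd_cont X"
  shows "(\<lambda>x\<in>topspace X. f x + g x) \<in> bdd_cont X"
proof -
  have "continuous_map X euclidean (\<lambda>x. f x + g x)"
    using assms by (intro continuous_map_add) (auto simp: bdd_cont_def)
  moreover have "bounded ((\<lambda>x. f x + g x) ` topspace X)"
    using assms by (intro bounded_plus_comp) (auto simp: bdd_cont_def)
  ultimately show ?thesis
    by (rule restrict_in_bdd_cont)
qed

lemma bdd_cont_scale: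
  assumes "f \<in> bdd_cont X"
  shows "(\<lambda>x\<in>topspace X. c * f x) \<in> bdd_cont X"
proof -
  have "continuous_map euclidean euclidean (\<lambda>z. c * z)"
    by (simp add: continuous_on_mult_left)
  from continuous_map_compose[OF _ this, of X f]
  have "continuous_map X euclidean (\<lambda>x. c * f x)"
    using assms by (simp add: bdd_cont_def o_def)
  moreover have "bounded ((\<lambda>x. c * f x) ` topspace X)"
  proof -
    obtain b where "\<forall>x\<in>topspace X. norm (f x) \<le> b"
      using assms by (auto simp: bdd_cont_def bounded_iff)
    then have "\<forall>x\<in>topspace X. norm (c * f x) \<le> norm c * b"
      by (simp add: norm_mult mult_left_mono)
    then show ?thesis
      by (auto simp: bounded_iff)
  qed
  ultimately show ?thesis
    by (rule restrict_in_bdd_cont)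
qed

text \<open>The Hahn--Banach theorem above lives on a type. Bounded functions on a subset of \<open>'a\<close> embed
isometrically, by zero extension, into the normed space of all bounded functions on \<open>'a\<close>, which are
the bounded continuous functions for the discrete topology.\<close>

definition to_bcontfun :: "'a topology \<Rightarrow> ('a \<Rightarrow> complex) \<Rightarrow> 'a discrete \<Rightarrow>\<^sub>C complex" where
  "to_bcontfun X f = Bcontfun (\<lambda>d. if of_discrete d \<in> topspace X then f (of_discrete d) else 0)"

lemma apply_to_bcontfun:
  assumes "f \<in> bdd_cont X"
  shows "apply_bcontfun (to_bcontfun X f) d =
    (if of_discrete d \<in> topspace X then f (of_discrete d) else 0)"
proof -
  let ?g = "\<lambda>d. if of_discrete d \<in> topspace X then f (of_discrete d) else 0"
  have "?g \<in> bcontfun"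
  proof (rule bcontfun_normI)
    show "continuous_on UNIV ?g"
      by (auto simp: continuous_on_open_invariant open_discrete)
    show "norm (?g d) \<le> max 0 (sup_norm X f)" for d
      using bdd_cont_norm_le_sup_norm[OF assms] by (auto simp: le_max_iff_disj)
  qed
  then show ?thesis
    by (simp add: to_bcontfun_def Bcontfun_inverse)
qed

lemma norm_to_bcontfun:
  assumes "f \<in> bdd_cont X" "topspace X \<noteq> {}"
  shows "norm (to_bcontfun X f) = sup_norm X f"
proof (rule antisym)
  obtain t where t: "t \<in> topspace X"
    using assms(2) by blast
  have "0 \<le> sup_norm X f"
    using bdd_cont_norm_le_sup_norm[OF assms(1) t] norm_ge_zero order_trans by blast
  then show "norm (to_bcontfun X f) \<le> sup_norm X f"
    using bdd_cont_norm_le_sup_norm[OF assms(1)]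
    by (intro norm_bound) (auto simp: apply_to_bcontfun[OF assms(1)])
  show "sup_norm X f \<le> norm (to_bcontfun X f)"
    unfolding sup_norm_def
  proof (rule cSUP_least[OF assms(2)])
    fix x assume "x \<in> topspace X"
    then show "norm (f x) \<le> norm (to_bcontfun X f)"
      using norm_bounded[of "to_bcontfun X f" "discrete x"]
      by (simp add: apply_to_bcontfun[OF assms(1)] discrete_inverse)
  qed
qed

lemma to_bcontfun_add:
  assumes "f \<in> bdd_cont X" "g \<in> bdd_cont X"
  shows "to_bcontfun X (\<lambda>x\<in>topspace X. f x + g x) = to_bcontfun X f + to_bcontfun X g"
  using assms bdd_cont_add[OF assms]
  by (intro bcontfun_eqI) (simp add: apply_to_bcontfun)

lemma to_bcontfun_scale:
  assumes "f \<in> bdd_cont X"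
  shows "to_bcontfun X (\<lambda>x\<in>topspace X. c * f x) =
    Re c *\<^sub>R to_bcontfun X f + Im c *\<^sub>R to_bcontfun X (\<lambda>x\<in>topspace X. \<i> * f x)"
  using assms bdd_cont_scale[OF assms]
  by (intro bcontfun_eqI) (simp add: apply_to_bcontfun complex_eq_iff)

lemma compose_in_bdd_cont:
  assumes "continuous_map X Y q" "h \<in> bdd_cont Y"
  shows "compose (topspace X) h q \<in> bdd_cont X"
proof -
  have "continuous_map X euclidean (h \<circ> q)"
    using assms by (intro continuous_map_compose) (auto simp: bdd_cont_def)
  moreover have "bounded ((h \<circ> q) ` topspace X)"
    using assms continuous_map_image_subset_topspace[OF assms(1)]
    by (auto simp: bdd_cont_def image_comp [symmetric] intro: bounded_subset)
  ultimately show ?thesis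
    using restrict_in_bdd_cont[of X "h \<circ> q"] by (simp add: compose_def)
qed

lemma sup_norm_compose:
  assumes "q ` topspace X = topspace Y"
  shows "sup_norm X (compose (topspace X) h q) = sup_norm Y h"
  unfolding sup_norm_def compose_def assms[symmetric] image_image by simp

lemma compose_inject:
  assumes "q ` topspace X = topspace Y" "h \<in> bdd_cont Y" "h' \<in> bdd_cont Y"
    and eq: "compose (topspace X) h q = compose (topspace X) h' q"
  shows "h = h'"
proof (rule bdd_cont_eqI[OF assms(2,3)])
  fix y assume "y \<in> topspace Y"
  then obtain x where x: "x \<in> topspace X" "y = q x"
    using assms(1) by blast
  then show "h y = h' y"
    using fun_cong[OF eq, of x] by (simp add: compose_def)
qed

lemma compose_restrict_add:
  assumes "continuous_map X Y q"
  shows "compose (topspace X) (\<lambda>y\<in>topspace Y. h y + h' y) q =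
    (\<lambda>x\<in>topspace X. compose (topspace X) h q x + compose (topspace X) h' q x)"
  using continuous_map_image_subset_topspace[OF assms]
  by (auto simp: compose_def restrict_def fun_eq_iff image_subset_iff)

lemma compose_restrict_scale:
  assumes "continuous_map X Y q"
  shows "compose (topspace X) (\<lambda>y\<in>topspace Y. c * h y) q =
    (\<lambda>x\<in>topspace X. c * compose (topspace X) h q x)"
  using continuous_map_image_subset_topspace[OF assms]
  by (auto simp: compose_def restrict_def fun_eq_iff image_subset_iff)

lemma bdd_cont_dual_compose:
  assumes q: "continuous_map X Y q" "q ` topspace X = topspace Y" and \<phi>: "\<phi> \<in> bdd_cont_dual X"
  shows "(\<lambda>h. \<phi> (compose (topspace X) h q)) \<in> bdd_cont_dual Y"
proof -
  obtain B where "\<forall>f\<in>bdd_cont X. norm (\<phi> f) \<le> B * sup_norm X f"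
    using \<phi> by (auto simp: bdd_cont_dual_def)
  then have "\<forall>h\<in>bdd_cont Y. norm (\<phi> (compose (topspace X) h q)) \<le> B * sup_norm Y h"
    using compose_in_bdd_cont[OF q(1)] by (metis sup_norm_compose[OF q(2)])
  then show ?thesis
    using \<phi> compose_in_bdd_cont[OF q(1)]
    by (auto simp: bdd_cont_dual_def compose_restrict_add[OF q(1)] compose_restrict_scale[OF q(1)])
qed

lemma continuous_map_weak_topologyI:
  assumes "f ` topspace Z \<subseteq> bdd_cont X"
    and "\<And>\<phi>. \<phi> \<in> bdd_cont_dual X \<Longrightarrow> continuous_map Z euclidean (\<lambda>z. \<phi> (f z))"
  shows "continuous_map Z (weak_topology X) f"
  unfolding weak_topology_def
proof (rule continuous_on_generated_topo)
  show "f ` topspace Z \<subseteq> \<Union> {{f \<in> bdd_cont X. \<phi> f \<in> U} |\<phi> U. \<phi> \<in> bdd_cont_dual X \<and> open U}"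
    using assms(1) topspace_weak_topology[of X]
    unfolding weak_topology_def topology_generated_by_topspace by simp
  fix A assume "A \<in> {{f \<in> bdd_cont X. \<phi> f \<in> U} |\<phi> U. \<phi> \<in> bdd_cont_dual X \<and> open U}"
  then obtain \<phi> U where A: "A = {f \<in> bdd_cont X. \<phi> f \<in> U}" "\<phi> \<in> bdd_cont_dual X" "open U"
    by blast
  have "openin Z {z \<in> topspace Z. \<phi> (f z) \<in> U}"
    using A by (intro openin_continuous_map_preimage[OF assms(2)]) auto
  moreover have "{z \<in> topspace Z. \<phi> (f z) \<in> U} = f -` A \<inter> topspace Z"
    using assms(1) A by auto
  ultimately show "openin Z (f -` A \<inter> topspace Z)"
    by simp
qed

text \<open>Composition with a surjection \<open>q\<close> embeds \<open>C(Y)\<close> isometrically into \<open>C(X)\<close>, so functionals on \<open>C(Y)\<close>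
extend. The real part of \<open>\<psi>\<close> is extended to a real functional \<open>U\<close>, and the complex extension is
\<open>U f - \<i> U(\<i> f)\<close> as usual.\<close>

lemma bdd_cont_dual_extend:
  assumes q: "continuous_map X Y q" "q ` topspace X = topspace Y" and ne: "topspace X \<noteq> {}"
    and \<psi>: "\<psi> \<in> bdd_cont_dual Y"
  obtains \<Psi> where "\<Psi> \<in> bdd_cont_dual X"
    "\<And>h. h \<in> bdd_cont Y \<Longrightarrow> \<Psi> (compose (topspace X) h q) = \<psi> h"
proof -
  let ?P = "\<lambda>h. compose (topspace X) h q" and ?J = "to_bcontfun X"
  let ?i = "\<lambda>f. \<lambda>x\<in>topspace X. \<i> * f x"
  have \<psi>_add: "\<psi> (\<lambda>y\<in>topspace Y. h y + h' y) = \<psi> h + \<psi> h'"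
    if "h \<in> bdd_cont Y" "h' \<in> bdd_cont Y" for h h'
    using \<psi> that by (auto simp: bdd_cont_dual_def)
  have \<psi>_scale: "\<psi> (\<lambda>y\<in>topspace Y. c * h y) = c * \<psi> h" if "h \<in> bdd_cont Y" for h c
    using \<psi> that by (auto simp: bdd_cont_dual_def)
  obtain B0 where B0: "\<And>h. h \<in> bdd_cont Y \<Longrightarrow> norm (\<psi> h) \<le> B0 * sup_norm Y h"
    using \<psi> unfolding bdd_cont_dual_def by blast
  define B where "B = \<bar>B0\<bar>"
  have P: "?P h \<in> bdd_cont X" if "h \<in> bdd_cont Y" for h
    using compose_in_bdd_cont[OF q(1) that] .
  have normJ: "norm (?J (?P h)) = sup_norm Y h" if "h \<in> bdd_cont Y" for h
    by (simp add: norm_to_bcontfun[OF P[OF that] ne] sup_norm_compose[OF q(2)])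
  define g where "g = (\<lambda>h. (?J (?P h), Re (\<psi> h))) ` bdd_cont Y"
  have "subspace g"
  proof (rule subspaceI)
    have z: "(\<lambda>y\<in>topspace Y. 0) \<in> bdd_cont Y"
      by (rule restrict_in_bdd_cont) (auto simp: bounded_iff)
    have "?J (?P (\<lambda>y\<in>topspace Y. 0)) = 0"
      using compose_restrict_scale[OF q(1), of 0 "\<lambda>_. 0"] P[OF z] q(2)
      by (intro bcontfun_eqI) (auto simp: apply_to_bcontfun compose_def)
    moreover have "\<psi> (\<lambda>y\<in>topspace Y. 0) = 0"
      using \<psi>_scale[OF z, of 0] by (simp cong: restrict_cong)
    ultimately show "0 \<in> g"
      unfolding g_def zero_prod_def using z by (intro image_eqI[where x="\<lambda>y\<in>topspace Y. 0"]) auto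
    show "x + y \<in> g" if xy: "x \<in> g" "y \<in> g" for x y
    proof -
      obtain h h' where h: "h \<in> bdd_cont Y" "h' \<in> bdd_cont Y"
          "x = (?J (?P h), Re (\<psi> h))" "y = (?J (?P h'), Re (\<psi> h'))"
        using xy unfolding g_def by blast
      show ?thesis
        unfolding g_def
        by (rule image_eqI[OF _ bdd_cont_add[OF h(1,2)]])
          (simp add: h \<psi>_add compose_restrict_add[OF q(1)] to_bcontfun_add P)
    qed
    show "c *\<^sub>R x \<in> g" if xg: "x \<in> g" for c x
    proof -
      obtain h where h: "h \<in> bdd_cont Y" "x = (?J (?P h), Re (\<psi> h))"
        using xg unfolding g_def by blast
      show ?thesis
        unfolding g_def
        by (rule image_eqI[OF _ bdd_cont_scale[OF h(1), of "of_real c"]])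
          (simp add: h(2) \<psi>_scale[OF h(1)] compose_restrict_scale[OF q(1)]
            to_bcontfun_scale[OF P[OF h(1)], of "of_real c"])
    qed
  qed
  have "\<exists>U. linear U \<and> (\<forall>v r. (v, r) \<in> g \<longrightarrow> U v = r) \<and> (\<forall>v. U v \<le> B * norm v)"
  proof (rule Hahn_Banach_graph[OF _ _ \<open>subspace g\<close>])
    show "B * norm (x + y) \<le> B * norm x + B * norm y" for x y :: "'a discrete \<Rightarrow>\<^sub>C complex"
      by (metis B_def abs_ge_zero distrib_left mult_left_mono norm_triangle_ineq)
    show "B * norm (t *\<^sub>R x) = t * (B * norm x)" if "t > 0" for t and x :: "'a discrete \<Rightarrow>\<^sub>C complex"
      using that by simp
    show "r \<le> B * norm v" if vr: "(v, r) \<in> g" for v r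
    proof -
      obtain h where h: "h \<in> bdd_cont Y" "v = ?J (?P h)" "r = Re (\<psi> h)"
        using vr by (auto simp: g_def)
      have "r \<le> norm (\<psi> h)"
        by (simp add: h complex_Re_le_cmod)
      also have "\<dots> \<le> B0 * norm v"
        using B0[OF h(1)] by (simp add: h normJ)
      also have "\<dots> \<le> B * norm v"
        by (simp add: B_def mult_right_mono)
      finally show ?thesis .
    qed
  qed blast
  then obtain U where U: "linear U" "\<And>h. h \<in> bdd_cont Y \<Longrightarrow> U (?J (?P h)) = Re (\<psi> h)"
      "\<And>v. U v \<le> B * norm v"
    unfolding g_def by blast
  have Uabs: "\<bar>U v\<bar> \<le> B * norm v" for v
    using U(3)[of v] U(3)[of "- v"] by (simp add: linear_neg[OF U(1)])
  define \<Psi> where "\<Psi> f = Complex (U (?J f)) (- U (?J (?i f)))" for f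
  show thesis
  proof
    have i: "?i f \<in> bdd_cont X" if "f \<in> bdd_cont X" for f
      using bdd_cont_scale[OF that] .
    have "\<Psi> (\<lambda>x\<in>topspace X. f x + g x) = \<Psi> f + \<Psi> g"
      if fg: "f \<in> bdd_cont X" "g \<in> bdd_cont X" for f g
    proof -
      have "?i (\<lambda>x\<in>topspace X. f x + g x) = (\<lambda>x\<in>topspace X. ?i f x + ?i g x)"
        by (auto simp: fun_eq_iff restrict_def algebra_simps)
      then have "?J (?i (\<lambda>x\<in>topspace X. f x + g x)) = ?J (?i f) + ?J (?i g)"
        by (simp only: to_bcontfun_add[OF i[OF fg(1)] i[OF fg(2)]])
      then show ?thesis
        unfolding \<Psi>_def to_bcontfun_add[OF fg]
        by (simp only: linear_add[OF U(1)] complex_eq_iff) simp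
    qed
    moreover have "\<Psi> (\<lambda>x\<in>topspace X. c * f x) = c * \<Psi> f" if f: "f \<in> bdd_cont X" for f c
    proof -
      have "?i (\<lambda>x\<in>topspace X. c * f x) = (\<lambda>x\<in>topspace X. (\<i> * c) * f x)"
        by (auto simp: fun_eq_iff restrict_def algebra_simps)
      then have "?J (?i (\<lambda>x\<in>topspace X. c * f x)) = (- Im c) *\<^sub>R ?J f + Re c *\<^sub>R ?J (?i f)"
        using to_bcontfun_scale[OF f, of "\<i> * c"] by simp
      then show ?thesis
        unfolding \<Psi>_def to_bcontfun_scale[OF f, of c]
        by (simp only: linear_add[OF U(1)] linear_scale[OF U(1)] complex_eq_iff) simp
    qed
    moreover have "norm (\<Psi> f) \<le> (2 * B) * sup_norm X f" if f: "f \<in> bdd_cont X" for f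
    proof -
      have "norm (\<Psi> f) \<le> \<bar>U (?J f)\<bar> + \<bar>U (?J (?i f))\<bar>"
        using cmod_le[of "\<Psi> f"] by (simp add: \<Psi>_def)
      also have "\<dots> \<le> B * norm (?J f) + B * norm (?J (?i f))"
        by (intro add_mono Uabs)
      also have "\<dots> = (2 * B) * sup_norm X f"
      proof -
        have "sup_norm X (?i f) = sup_norm X f"
          by (simp add: sup_norm_def norm_mult cong: image_cong_simp)
        with norm_to_bcontfun[OF i[OF f] ne] have n: "norm (?J (?i f)) = sup_norm X f"
          by (rule trans)
        show ?thesis
          unfolding norm_to_bcontfun[OF f ne] n by simp
      qed
      finally show ?thesis .
    qed
    ultimately show "\<Psi> \<in> bdd_cont_dual X"
      unfolding bdd_cont_dual_def by blast
    show "\<Psi> (?P h) = \<psi> h" if h: "h \<in> bdd_cont Y" for h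
    proof -
      have "U (?J (?i (?P h))) = Re (\<i> * \<psi> h)"
        using U(2)[OF bdd_cont_scale[OF h, of \<i>]]
        by (simp add: compose_restrict_scale[OF q(1)] \<psi>_scale[OF h])
      then show ?thesis
        by (simp add: \<Psi>_def U(2)[OF h] complex_eq_iff)
    qed
  qed
qed

lemma in_bdd_cont_if_compose:
  assumes q: "quotient_map X Y q" and g: "g \<in> extensional (topspace Y)"
    and gq: "compose (topspace X) g q \<in> bdd_cont X"
  shows "g \<in> bdd_cont Y"
proof -
  have surj: "q ` topspace X = topspace Y"
    using q quotient_imp_surjective_map by blast
  have "continuous_map X euclidean (g \<circ> q)"
    using gq by (auto simp: bdd_cont_def compose_def intro: continuous_map_eq)
  then have "continuous_map Y euclidean g"
    using continuous_compose_quotient_map_eq[OF q] by blast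
  moreover have "g ` topspace Y = compose (topspace X) g q ` topspace X"
    unfolding surj[symmetric] image_image by (simp add: compose_def)
  ultimately show ?thesis
    using g gq by (simp add: bdd_cont_def)
qed

lemma bdd_cont_factor:
  assumes q: "quotient_map X Y q" and f: "f \<in> bdd_cont X"
    and const: "\<And>x x'. \<lbrakk>x \<in> topspace X; x' \<in> topspace X; q x = q x'\<rbrakk> \<Longrightarrow> f x = f x'"
  obtains h where "h \<in> bdd_cont Y" "f = compose (topspace X) h q"
proof -
  have surj: "q ` topspace X = topspace Y"
    using q quotient_imp_surjective_map by blast
  define h where "h = (\<lambda>y\<in>topspace Y. f (SOME x. x \<in> topspace X \<and> q x = y))"
  have hq: "h (q x) = f x" if x: "x \<in> topspace X" for x
  proof -
    have "(SOME x'. x' \<in> topspace X \<and> q x' = q x) \<in> topspace X \<and>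
        q (SOME x'. x' \<in> topspace X \<and> q x' = q x) = q x"
      using x by (intro someI[of "\<lambda>x'. x' \<in> topspace X \<and> q x' = q x" x]) simp
    then have "f (SOME x'. x' \<in> topspace X \<and> q x' = q x) = f x"
      using const x by blast
    then show ?thesis
      using x surj by (auto simp: h_def)
  qed
  have "f = compose (topspace X) h q"
    using f hq by (auto simp: bdd_cont_def extensional_def compose_def fun_eq_iff restrict_def)
  moreover from this have "h \<in> bdd_cont Y"
    using f by (intro in_bdd_cont_if_compose[OF q]) (auto simp: h_def)
  ultimately show thesis
    using that by blast
qed

text \<open>Passing to the quotient does not change relative weak compactness. From \<open>Y\<close> to \<open>X\<close> this is the weak
continuity of composition with \<open>q\<close>. From \<open>X\<close> to \<open>Y\<close> one needs two facts about the space of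
functions that are constant on the fibres of \<open>q\<close>: it is weakly closed, being cut out by point
evaluations, and its own weak topology is the one induced from \<open>C(X)\<close>, by the extension of functionals.\<close>

lemma relatively_weakly_compact_compose:
  assumes q: "quotient_map X Y q" and S: "S \<subseteq> bdd_cont Y"
  shows "relatively_weakly_compact X ((\<lambda>h. compose (topspace X) h q) ` S)
    \<longleftrightarrow> relatively_weakly_compact Y S" (is "relatively_weakly_compact X (?P ` S) \<longleftrightarrow> _")
proof
  have cont: "continuous_map X Y q" and surj: "q ` topspace X = topspace Y"
    using q quotient_imp_continuous_map quotient_imp_surjective_map by blast+
  have P: "?P h \<in> bdd_cont X" if "h \<in> bdd_cont Y" for h
    using compose_in_bdd_cont[OF cont that] .
  {
    assume "relatively_weakly_compact Y S"
    then have "compactin (weak_topology Y) (weak_topology Y closure_of S)"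
      by (simp add: relatively_weakly_compact_def)
    moreover have "continuous_map (weak_topology Y) (weak_topology X) ?P"
      using P bdd_cont_dual_compose[OF cont surj]
      by (intro continuous_map_weak_topologyI continuous_map_weak_topology_dual) auto
    ultimately have "compactin (weak_topology X) (?P ` (weak_topology Y closure_of S))"
      by (rule image_compactin)
    moreover have "S \<subseteq> weak_topology Y closure_of S"
      using S by (simp add: closure_of_subset)
    ultimately show "relatively_weakly_compact X (?P ` S)"
      by (meson image_mono relatively_weakly_compactI)
  }
  assume rel: "relatively_weakly_compact X (?P ` S)"
  define A where "A = weak_topology X closure_of (?P ` S)"
  have A: "compactin (weak_topology X) A"
    using rel by (simp add: relatively_weakly_compact_def A_def)
  have sub: "?P ` S \<subseteq> A"
    unfolding A_def using P S by (intro closure_of_subset) auto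
  have AX: "A \<subseteq> bdd_cont X"
    unfolding A_def using closure_of_subset_topspace by fastforce
  show "relatively_weakly_compact Y S"
  proof (cases "topspace X = {}")
    case True
    then have "topspace Y = {}"
      using surj by simp
    then have "bdd_cont Y \<subseteq> {\<lambda>_. undefined}"
      by (auto simp: bdd_cont_def)
    then have "finite S"
      using finite_subset[OF subset_trans[OF S]] by simp
    then show ?thesis
      using S by (intro relatively_weakly_compactI[of _ S] finite_imp_compactin) auto
  next
    case False
    have "\<exists>h\<in>bdd_cont Y. f = ?P h" if f: "f \<in> A" for f
    proof -
      have "f x = f x'" if "x \<in> topspace X" "x' \<in> topspace X" "q x = q x'" for x x'
      proof -
        have "continuous_map (weak_topology X) euclidean (\<lambda>f. f x - f x')"
          using that by (intro continuous_map_diff continuous_map_weak_topology_eval)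
        from closedin_continuous_map_preimage[OF this, of "{0}"]
        have "closedin (weak_topology X) {f \<in> bdd_cont X. f x = f x'}"
          by simp
        moreover have "?P ` S \<subseteq> {f \<in> bdd_cont X. f x = f x'}"
          using P S that by (auto simp: compose_def)
        ultimately have "A \<subseteq> {f \<in> bdd_cont X. f x = f x'}"
          unfolding A_def by (rule closure_of_minimal[rotated])
        then show ?thesis
          using f by blast
      qed
      then show ?thesis
        using bdd_cont_factor[OF q, of f] f AX by blast
    qed
    then obtain L where L: "\<And>f. f \<in> A \<Longrightarrow> L f \<in> bdd_cont Y \<and> f = ?P (L f)"
      by metis
    have "continuous_map (subtopology (weak_topology X) A) (weak_topology Y) L"
    proof (rule continuous_map_weak_topologyI)
      show "L ` topspace (subtopology (weak_topology X) A) \<subseteq> bdd_cont Y"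
        using L by auto
      fix \<psi> assume "\<psi> \<in> bdd_cont_dual Y"
      then obtain \<Psi> where \<Psi>: "\<Psi> \<in> bdd_cont_dual X" "\<And>h. h \<in> bdd_cont Y \<Longrightarrow> \<Psi> (?P h) = \<psi> h"
        using bdd_cont_dual_extend[OF cont surj False] by metis
      have "continuous_map (subtopology (weak_topology X) A) euclidean \<Psi>"
        using \<Psi>(1) continuous_map_from_subtopology continuous_map_weak_topology_dual by blast
      moreover have "\<Psi> f = \<psi> (L f)" if "f \<in> topspace (subtopology (weak_topology X) A)" for f
        using that L[of f] \<Psi>(2)[of "L f"] by auto
      ultimately show "continuous_map (subtopology (weak_topology X) A) euclidean (\<lambda>f. \<psi> (L f))"
        by (rule continuous_map_eq)
    qed
    moreover have "compactin (subtopology (weak_topology X) A) A"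
      using A by (simp add: compactin_subtopology)
    ultimately have "compactin (weak_topology Y) (L ` A)"
      using image_compactin by blast
    moreover have "S \<subseteq> L ` A"
    proof
      fix h assume h: "h \<in> S"
      then have "?P h \<in> A"
        using sub by blast
      then have "h = L (?P h)"
        using L[of "?P h"] h S compose_inject[OF surj, of h "L (?P h)"] by auto
      then show "h \<in> L ` A"
        using \<open>?P h \<in> A\<close> by blast
    qed
    ultimately show ?thesis
      by (rule relatively_weakly_compactI)
  qed
qed

section \<open>Functions on the quotient group\<close>

lemma (in normal) double_orbit_compose_coset:
  "double_orbit G (compose (carrier G) h (\<lambda>x. H #> x)) =
    (\<lambda>g. compose (carrier G) g (\<lambda>x. H #> x)) ` double_orbit (G Mod H) h"
proof -
  have eq: "compose (carrier G) (\<lambda>Z\<in>carrier (G Mod H). h ((H #> x) <#> Z <#> (H #> y))) (\<lambda>x. H #> x)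
      = (\<lambda>z\<in>carrier G. compose (carrier G) h (\<lambda>x. H #> x) (x \<otimes> z \<otimes> y))"
    if "x \<in> carrier G" "y \<in> carrier G" for x y
    using that by (auto simp: compose_def carrier_FactGroup rcos_sum fun_eq_iff)
  show ?thesis
  proof (intro subset_antisym subsetI)
    fix g assume "g \<in> double_orbit G (compose (carrier G) h (\<lambda>x. H #> x))"
    then obtain x y where xy: "x \<in> carrier G" "y \<in> carrier G"
        "g = (\<lambda>z\<in>carrier G. compose (carrier G) h (\<lambda>x. H #> x) (x \<otimes> z \<otimes> y))"
      by (auto simp: double_orbit_def)
    then have "H #> x \<in> carrier (G Mod H)" "H #> y \<in> carrier (G Mod H)"
      by (simp_all add: carrier_FactGroup)
    then show "g \<in> (\<lambda>g. compose (carrier G) g (\<lambda>x. H #> x)) ` double_orbit (G Mod H) h"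
      unfolding double_orbit_def xy(3) eq[OF xy(1,2), symmetric] mult_FactGroup by blast
  next
    fix g assume "g \<in> (\<lambda>g. compose (carrier G) g (\<lambda>x. H #> x)) ` double_orbit (G Mod H) h"
    then obtain X Y where XY: "X \<in> carrier (G Mod H)" "Y \<in> carrier (G Mod H)"
        "g = compose (carrier G) (\<lambda>Z\<in>carrier (G Mod H). h (X <#> Z <#> Y)) (\<lambda>x. H #> x)"
      by (auto simp: double_orbit_def)
    then obtain x y where xy: "x \<in> carrier G" "y \<in> carrier G" "X = H #> x" "Y = H #> y"
      by (auto simp: carrier_FactGroup)
    show "g \<in> double_orbit G (compose (carrier G) h (\<lambda>x. H #> x))"
      unfolding double_orbit_def XY(3) xy(3,4) eq[OF xy(1,2)] using xy(1,2) by blast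
  qed
qed

theorem theorem2p6:
  fixes G :: "('a, 'b) monoid_scheme" (structure) and T :: "'a topology"
  assumes "IN_group G T"
  shows "WS G T =
    {compose (carrier G) h (\<lambda>x. IN_kernel G T #> x) | h.
       h \<in> WS (G Mod IN_kernel G T) (coset_topology G T (IN_kernel G T))}"
proof -
  interpret IN_group G T
    by (rule assms)
  define K where "K = IN_kernel G T"
  define Y where "Y = coset_topology G T K"
  let ?P = "\<lambda>h. compose (carrier G) h (\<lambda>x. K #> x)"
  interpret K: normal K G
    unfolding K_def by (rule normal_IN_kernel)
  have q: "quotient_map T Y (\<lambda>x. K #> x)"
    unfolding Y_def coset_topology_def by (rule quotient_map_quotient_top)
  have TG: "topspace T = carrier G"
    by (rule topspace_eq_carrier)
  have topY: "topspace Y = carrier (G Mod K)"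
    by (simp add: Y_def coset_topology_def TG carrier_FactGroup)
  have WS_iff: "?P h \<in> WS G T \<longleftrightarrow> h \<in> WS (G Mod K) Y" if h: "h \<in> bdd_cont Y" for h
  proof -
    have ext: "double_orbit (G Mod K) h \<subseteq> extensional (topspace Y)"
      by (auto simp: double_orbit_def topY)
    have rel: "relatively_weakly_compact T (?P ` double_orbit (G Mod K) h) \<longleftrightarrow>
        relatively_weakly_compact Y (double_orbit (G Mod K) h)"
    proof (cases "double_orbit (G Mod K) h \<subseteq> bdd_cont Y")
      case True
      then show ?thesis
        using relatively_weakly_compact_compose[OF q True] by (simp add: TG)
    next
      case False
      then have "\<not> ?P ` double_orbit (G Mod K) h \<subseteq> bdd_cont T"
        using in_bdd_cont_if_compose[OF q] ext by (auto simp: TG)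
      with False show ?thesis
        by (simp add: relatively_weakly_compact_def)
    qed
    have "?P h \<in> bdd_cont T"
      using compose_in_bdd_cont[OF quotient_imp_continuous_map[OF q] h] by (simp add: TG)
    then show ?thesis
      using h rel by (simp add: WS_def K.double_orbit_compose_coset)
  qed
  show ?thesis
    unfolding K_def[symmetric] Y_def[symmetric]
  proof (intro subset_antisym subsetI)
    fix f assume f: "f \<in> WS G T"
    have const: "f x = f x'" if x: "x \<in> carrier G" "x' \<in> carrier G" and eq: "K #> x = K #> x'" for x x'
    proof -
      have "x' \<in> K #> x"
        unfolding eq using x K.subgroup_axioms by (intro rcos_self)
      then obtain k where "k \<in> K" "x' = k \<otimes> x"
        by (auto simp: r_coset_def)
      then show ?thesis
        using WS_IN_kernel_invariant[OF f, of k x] x by (simp add: K_def)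
    qed
    have "f \<in> bdd_cont T"
      using f by (simp add: WS_def)
    then obtain h where h: "h \<in> bdd_cont Y" "f = ?P h"
      using const by (rule bdd_cont_factor[OF q, unfolded TG])
    then show "f \<in> {?P h |h. h \<in> WS (G Mod K) Y}"
      using f WS_iff by blast
  next
    fix f assume "f \<in> {?P h |h. h \<in> WS (G Mod K) Y}"
    then obtain h where h: "h \<in> WS (G Mod K) Y" "f = ?P h"
      by blast
    then show "f \<in> WS G T"
      using WS_iff[of h] by (simp add: WS_def)
  qed
qed

end
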